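(* Let $\mathcal{E}$ be a finite axiom system over $\mathrm{BCCSP}_{\|}$ that is sound modulo $\sim_{\mathtt{PF}}$, and let $N$ be larger than the size of each term in the equations in $\mathcal{E}$. Assume that $p$ and $q$ are closed terms that contain no occurrences of $\mathbf{0}$ as a summand or factor, and that $p\sim_{\mathtt{PF}}a\|p_N$ and $q\sim_{\mathtt{PF}}a\|p_N$. If $\mathcal{E}\vdash p\approx q$ and $p$ has a summand possible futures equivalent to $a\|p_N$, then so does $q$.
   Context: Let $\mathcal{A}$ be a finite set of actions containing two distinct actions $a\neq b$, and $\mathcal{V}$ a countably infinite set of variables. $\mathrm{BCCSP}_{\|}$ terms: $t ::= \mathbf{0} \mid x \mid c.t \mid t+t \mid t \,\|\, t$ ($c\in\mathcal{A}$, $x\in\mathcal{V}$); closed terms are processes; $a$ abbreviates $a.\mathbf{0}$. The size of a term is the number of operator symbols in it. Writing a term as $t_1+\dots+t_k$ with no $t_i$ having $+$ as head operator, the $t_i$ are its summands. Transitions: $c.p \xrightarrow{c} p$; if $p \xrightarrow{c} p'$ then $p+q \xrightarrow{c} p'$, $q+p \xrightarrow{c} p'$, $p\|q \xrightarrow{c} p'\|q$, $q \| p \xrightarrow{c} q \| p'$. For $\alpha\in\mathcal{A}^*$, $p\xrightarrow{\alpha}p'$ denotes a path labelled $\alpha$; $\mathtt{T}(p)$ is the set of such $\alpha$. A possible future of $p$ is $(\alpha,\mathtt{T}(p'))$ with $p\xrightarrow{\alpha}p'$; $p\sim_{\mathtt{PF}}q$ iff $p,q$ have the same possible futures; for terms,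 iff all closed instances are related. $\mathcal{E}$ is sound modulo $\sim_{\mathtt{PF}}$ if $\sigma(t)\sim_{\mathtt{PF}}\sigma(u)$ for each $t\approx u$ in $\mathcal{E}$ and each closed substitution $\sigma$. $\mathcal{E}\vdash t\approx u$: derivable in equational logic (reflexivity, symmetry, transitivity, substitution instances of equations of $\mathcal{E}$, closure under $c.\_$, $+$, $\|$). $b^0a=a.\mathbf{0}$, $b^{i+1}a=b.(b^ia)$, $p_N=\sum_{i=1}^N b^ia$. A term has $\mathbf{0}$ as a summand if it contains a subterm $t_1+t_2$ with $t_1$ or $t_2$ $\sim_{\mathtt{PF}}\mathbf{0}$, and as a factor if it contains a subterm $t_1\|t_2$ with $t_1$ or $t_2$ $\sim_{\mathtt{PF}}\mathbf{0}$. *)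

theory Defs
  imports "HOL-Library.Countable"
begin

(* The set of actions is the type 'a, the set of variables is the type 'v. *)

datatype (acts: 'a, vars: 'v) trm =
    Zero
  | Var 'v
  | Pre 'a "('a, 'v) trm"
  | Sum "('a, 'v) trm" "('a, 'v) trm"  (infixl \<open>\<oplus>\<close> 65)
  | Par "('a, 'v) trm" "('a, 'v) trm"  (infixl \<open>\<parallel>\<close> 70)

definition closed :: "('a, 'v) trm \<Rightarrow> bool" where
  "closed t \<longleftrightarrow> vars t = {}"

(* Number of operator symbols: the constant Zero is a (nullary) operator symbol,
   each prefix counts once, and variables do not count. *)
primrec tsize :: "('a, 'v) trm \<Rightarrow> nat" where
  "tsize Zero = 1"
| "tsize (Var x) = 0"
| "tsize (Pre c t) = 1 + tsize t"
| "tsize (t \<oplus> u) = 1 + tsize t + tsize u"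
| "tsize (t \<parallel> u) = 1 + tsize t + tsize u"

fun summands :: "('a, 'v) trm \<Rightarrow> ('a, 'v) trm set" where
  "summands (t \<oplus> u) = summands t \<union> summands u"
| "summands t = {t}"

primrec subterms :: "('a, 'v) trm \<Rightarrow> ('a, 'v) trm set" where
  "subterms Zero = {Zero}"
| "subterms (Var x) = {Var x}"
| "subterms (Pre c t) = insert (Pre c t) (subterms t)"
| "subterms (t \<oplus> u) = insert (t \<oplus> u) (subterms t \<union> subterms u)"
| "subterms (t \<parallel> u) = insert (t \<parallel> u) (subterms t \<union> subterms u)"

primrec tsubst :: "('v \<Rightarrow> ('a, 'w) trm) \<Rightarrow> ('a, 'v) trm \<Rightarrow> ('a, 'w) trm" where
  "tsubst \<sigma> Zero = Zero"
| "tsubst \<sigma> (Var x) = \<sigma> x"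
| "tsubst \<sigma> (Pre c t) = Pre c (tsubst \<sigma> t)"
| "tsubst \<sigma> (t \<oplus> u) = tsubst \<sigma> t \<oplus> tsubst \<sigma> u"
| "tsubst \<sigma> (t \<parallel> u) = tsubst \<sigma> t \<parallel> tsubst \<sigma> u"

definition closed_subst :: "('v \<Rightarrow> ('a, 'w) trm) \<Rightarrow> bool" where
  "closed_subst \<sigma> \<longleftrightarrow> (\<forall>x. closed (\<sigma> x))"

(* The rules are given on all terms for convenience (a variable has no transitions);
   the semantics below is only ever applied to closed terms, which are
   preserved by transitions. *)
inductive step :: "('a, 'v) trm \<Rightarrow> 'a \<Rightarrow> ('a, 'v) trm \<Rightarrow> bool" where
  pre: "step (Pre c p) c p"
| sum_left: "step p c p' \<Longrightarrow> step (p \<oplus> q) c p'"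
| sum_right: "step p c p' \<Longrightarrow> step (q \<oplus> p) c p'"
| par_left: "step p c p' \<Longrightarrow> step (p \<parallel> q) c (p' \<parallel> q)"
| par_right: "step p c p' \<Longrightarrow> step (q \<parallel> p) c (q \<parallel> p')"

inductive path :: "('a, 'v) trm \<Rightarrow> 'a list \<Rightarrow> ('a, 'v) trm \<Rightarrow> bool" where
  nil: "path p [] p"
| cons: "step p c p' \<Longrightarrow> path p' \<alpha> p'' \<Longrightarrow> path p (c # \<alpha>) p''"

definition traces :: "('a, 'v) trm \<Rightarrow> 'a list set" where
  "traces p = {\<alpha>. \<exists>p'. path p \<alpha> p'}"

definition possible_futures :: "('a, 'v) trm \<Rightarrow> ('a list \<times> 'a list set) set" where
  "possible_futures p = {(\<alpha>, traces p') | \<alpha> p'. path p \<alpha> p'}"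

(* Possible futures equivalence of processes, i.e. for closed p and q. *)
definition pf_equiv :: "('a, 'v) trm \<Rightarrow> ('a, 'v) trm \<Rightarrow> bool" where
  "pf_equiv p q \<longleftrightarrow> possible_futures p = possible_futures q"

(* The extension to arbitrary terms. *)
definition pf_equiv_trm :: "('a, 'v) trm \<Rightarrow> ('a, 'v) trm \<Rightarrow> bool" where
  "pf_equiv_trm t u \<longleftrightarrow>
     (\<forall>\<sigma> :: 'v \<Rightarrow> ('a, 'v) trm. closed_subst \<sigma> \<longrightarrow> pf_equiv (tsubst \<sigma> t) (tsubst \<sigma> u))"

lemma tsubst_closed: "vars t = {} \<Longrightarrow> tsubst \<sigma> t = t"
  by (induction t) auto

lemma pf_equiv_trm_closed:
  assumes "closed p" "closed q"
  shows "pf_equiv_trm p q \<longleftrightarrow> pf_equiv p q"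
proof -
  have "closed_subst (\<lambda>x :: 'b. Zero :: ('a, 'b) trm)"
    by (simp add: closed_subst_def closed_def)
  then show ?thesis
    using assms unfolding pf_equiv_trm_def closed_def by (auto simp: tsubst_closed)
qed

definition has_zero_summand :: "('a, 'v) trm \<Rightarrow> bool" where
  "has_zero_summand t \<longleftrightarrow>
     (\<exists>t1 t2. t1 \<oplus> t2 \<in> subterms t \<and> (pf_equiv_trm t1 Zero \<or> pf_equiv_trm t2 Zero))"

definition has_zero_factor :: "('a, 'v) trm \<Rightarrow> bool" where
  "has_zero_factor t \<longleftrightarrow>
     (\<exists>t1 t2. t1 \<parallel> t2 \<in> subterms t \<and> (pf_equiv_trm t1 Zero \<or> pf_equiv_trm t2 Zero))"

(* An axiom system is a set of pairs (t, u), each standing for the equation t = u. *)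
definition pf_sound :: "(('a, 'v) trm \<times> ('a, 'v) trm) set \<Rightarrow> bool" where
  "pf_sound E \<longleftrightarrow>
     (\<forall>(t, u) \<in> E. \<forall>\<sigma> :: 'v \<Rightarrow> ('a, 'v) trm. closed_subst \<sigma> \<longrightarrow>
        pf_equiv (tsubst \<sigma> t) (tsubst \<sigma> u))"

inductive derivable ::
  "(('a, 'v) trm \<times> ('a, 'v) trm) set \<Rightarrow> ('a, 'v) trm \<Rightarrow> ('a, 'v) trm \<Rightarrow> bool"
  for E where
  refl: "derivable E t t"
| sym: "derivable E t u \<Longrightarrow> derivable E u t"
| trans: "derivable E t u \<Longrightarrow> derivable E u v \<Longrightarrow> derivable E t v"
| inst: "(t, u) \<in> E \<Longrightarrow> derivable E (tsubst \<sigma> t) (tsubst \<sigma> u)"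
| pre: "derivable E t u \<Longrightarrow> derivable E (Pre c t) (Pre c u)"
| sum: "derivable E t u \<Longrightarrow> derivable E t' u' \<Longrightarrow> derivable E (t \<oplus> t') (u \<oplus> u')"
| par: "derivable E t u \<Longrightarrow> derivable E t' u' \<Longrightarrow> derivable E (t \<parallel> t') (u \<parallel> u')"

(* The process b^i a, a sequence of i actions b followed by a. *)
primrec bpow :: "'a \<Rightarrow> 'a \<Rightarrow> nat \<Rightarrow> ('a, 'v) trm" where
  "bpow b a 0 = Pre a Zero"
| "bpow b a (Suc i) = Pre b (bpow b a i)"

(* The sum of b^i a for i from 1 to N, bracketed to the left; only the empty sum
   (N = 0) is Zero, so that no summand Zero occurs for N > 0. *)
fun pN :: "'a \<Rightarrow> 'a \<Rightarrow> nat \<Rightarrow> ('a, 'v) trm" where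
  "pN a b 0 = Zero"
| "pN a b (Suc 0) = bpow b a 1"
| "pN a b (Suc (Suc n)) = pN a b (Suc n) \<oplus> bpow b a (Suc (Suc n))"

end

theory Submission
  imports Defs
begin

text \<open>The size bound on the axioms enters through the heads of an instance: the summands of a term
  after discarding parallel factors that a closed substitution \<open>\<sigma>\<close> makes trivial. If a parallel
  composition of two nontrivial processes has an initial \<open>a\<close> and all its futures are futures of
  \<open>a \<parallel> p\<^sub>N\<close>, then one factor is equivalent to \<open>a\<close> and the other to \<open>p\<^sub>N\<close>, because \<open>p\<^sub>N\<close> is
  parallel prime. Hence a process equivalent to \<open>a \<parallel> p\<^sub>N\<close> has a summand of the required kind iff one
  of its initial \<open>a\<close> moves comes from a nontrivial parallel head (\<open>par_move\<close>). This property
  depends only on initial actions and on which factors are trivial, so it passes through the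
  congruence rules even when intermediate terms of a derivation contain trivial summands or factors.

  For an instance \<open>\<sigma>(t) = \<sigma>(u)\<close> of an axiom, a parallel head \<open>v \<parallel> w\<close> of \<open>t\<close> has \<open>\<sigma>(v)\<close> equivalent
  to \<open>a\<close> and \<open>\<sigma>(w)\<close> to \<open>p\<^sub>N\<close>, say. As \<open>w\<close> has fewer than \<open>N\<close> heads, one of them is a variable \<open>x\<close>.
  Substituting \<open>a.b\<^sup>M\<close> with large \<open>M\<close> for \<open>x\<close>, the left side can do an \<open>a\<close> and reach the traces of
  \<open>a \<parallel> b\<^sup>M\<close>. The right side can match this only by moving an unguarded \<open>x\<close> of \<open>u\<close> that stands in
  parallel with something of depth one performing \<open>a\<close>.\<close>

section \<open>Transitions and paths\<close>

inductive_cases step_PreE: "step (Pre c p) d r"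
inductive_cases step_SumE: "step (p \<oplus> q) c r"
inductive_cases step_ParE: "step (p \<parallel> q) c r"
inductive_cases step_VarE: "step (Var x) c r"
inductive_cases step_ZeroE: "step Zero c r"

lemma step_simps [simp]:
  "\<not> step Zero c r"
  "\<not> step (Var x) c r"
  "step (Pre c p) d r \<longleftrightarrow> d = c \<and> r = p"
  "step (p \<oplus> q) c r \<longleftrightarrow> step p c r \<or> step q c r"
  by (auto elim: step_PreE step_SumE step_VarE step_ZeroE intro: step.intros)

lemma step_Par_iff:
  "step (p \<parallel> q) c r \<longleftrightarrow>
     (\<exists>p'. r = p' \<parallel> q \<and> step p c p') \<or> (\<exists>q'. r = p \<parallel> q' \<and> step q c q')"
  by (auto elim: step_ParE intro: step.intros)

lemma step_vars: "step p c p' \<Longrightarrow> vars p' \<subseteq> vars p"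
  by (induction rule: step.induct) auto

lemma path_Nil_iff [simp]: "path p [] r \<longleftrightarrow> r = p"
  by (auto elim: path.cases intro: path.intros)

lemma path_Cons_iff: "path p (c # \<alpha>) r \<longleftrightarrow> (\<exists>s. step p c s \<and> path s \<alpha> r)"
  by (auto elim: path.cases intro: path.intros)

lemma path_Zero_iff [simp]: "path Zero \<alpha> r \<longleftrightarrow> \<alpha> = [] \<and> r = Zero"
  by (cases \<alpha>) (auto simp: path_Cons_iff)

lemma path_append_iff: "path p (\<alpha> @ \<beta>) r \<longleftrightarrow> (\<exists>s. path p \<alpha> s \<and> path s \<beta> r)"
  by (induction \<alpha> arbitrary: p) (auto simp: path_Cons_iff)

text \<open>There is no synchronisation, so each step belongs to exactly one component; induction on
  the word sorts its letters between the two.\<close>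

lemma path_Par_iff:
  "path (p \<parallel> q) \<alpha> r \<longleftrightarrow>
     (\<exists>\<beta> \<gamma> p' q'. r = p' \<parallel> q' \<and> path p \<beta> p' \<and> path q \<gamma> q' \<and> \<alpha> \<in> shuffles \<beta> \<gamma>)"
proof (induction \<alpha> arbitrary: p q)
  case Nil
  then show ?case by auto
next
  case (Cons c \<alpha>)
  show ?case
  proof
    assume "path (p \<parallel> q) (c # \<alpha>) r"
    then obtain s where s: "step (p \<parallel> q) c s" "path s \<alpha> r"
      by (auto simp: path_Cons_iff)
    from s(1) consider p' where "s = p' \<parallel> q" "step p c p'" | q' where "s = p \<parallel> q'" "step q c q'"
      by (auto simp: step_Par_iff)
    then show "\<exists>\<beta> \<gamma> p' q'. r = p' \<parallel> q' \<and> path p \<beta> p' \<and> path q \<gamma> q' \<and> c # \<alpha> \<in> shuffles \<beta> \<gamma>"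
    proof cases
      case 1
      with s(2) Cons[of p' q] obtain \<beta> \<gamma> p'' q'' where
        "r = p'' \<parallel> q''" "path p' \<beta> p''" "path q \<gamma> q''" "\<alpha> \<in> shuffles \<beta> \<gamma>" by auto
      with 1 show ?thesis
        by (intro exI[of _ "c # \<beta>"] exI[of _ \<gamma>] exI[of _ p''] exI[of _ q''])
          (auto simp: path_Cons_iff Cons_in_shuffles_iff)
    next
      case 2
      with s(2) Cons[of p q'] obtain \<beta> \<gamma> p'' q'' where
        "r = p'' \<parallel> q''" "path p \<beta> p''" "path q' \<gamma> q''" "\<alpha> \<in> shuffles \<beta> \<gamma>" by auto
      with 2 show ?thesis
        by (intro exI[of _ \<beta>] exI[of _ "c # \<gamma>"] exI[of _ p''] exI[of _ q''])
          (auto simp: path_Cons_iff Cons_in_shuffles_iff)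
    qed
  next
    assume "\<exists>\<beta> \<gamma> p' q'. r = p' \<parallel> q' \<and> path p \<beta> p' \<and> path q \<gamma> q' \<and> c # \<alpha> \<in> shuffles \<beta> \<gamma>"
    then obtain \<beta> \<gamma> p' q' where *: "r = p' \<parallel> q'" "path p \<beta> p'" "path q \<gamma> q'"
      "c # \<alpha> \<in> shuffles \<beta> \<gamma>" by blast
    from *(4) consider \<beta>' where "\<beta> = c # \<beta>'" "\<alpha> \<in> shuffles \<beta>' \<gamma>"
      | \<gamma>' where "\<gamma> = c # \<gamma>'" "\<alpha> \<in> shuffles \<beta> \<gamma>'"
      by (cases \<beta>; cases \<gamma>) (auto simp: Cons_in_shuffles_iff)
    then show "path (p \<parallel> q) (c # \<alpha>) r"
    proof cases
      case 1
      with * obtain s where "step p c s" "path s \<beta>' p'" by (auto simp: path_Cons_iff)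
      with 1 * Cons[of s q] show ?thesis
        by (auto simp: path_Cons_iff step_Par_iff)
    next
      case 2
      with * obtain s where "step q c s" "path s \<gamma>' q'" by (auto simp: path_Cons_iff)
      with 2 * Cons[of p s] show ?thesis
        by (auto simp: path_Cons_iff step_Par_iff)
    qed
  qed
qed

section \<open>Traces and possible futures\<close>

lemma Nil_in_traces [simp]: "[] \<in> traces p"
  using path.nil by (auto simp: traces_def)

lemma traces_Par: "traces (p \<parallel> q) = (\<Union>\<beta> \<in> traces p. \<Union>\<gamma> \<in> traces q. shuffles \<beta> \<gamma>)"
  unfolding traces_def path_Par_iff by blast

text \<open>The right-hand side mentions \<open>p\<close> and \<open>q\<close> only through their
  possible futures, so the congruence \<open>futures_Par_cong\<close> follows by rewriting.\<close>

lemma possible_futures_Par: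
  "possible_futures (p \<parallel> q) =
     {(\<alpha>, \<Union>\<beta> \<in> X. \<Union>\<gamma> \<in> Y. shuffles \<beta> \<gamma>) | \<alpha> X Y.
        \<exists>\<beta> \<gamma>. (\<beta>, X) \<in> possible_futures p \<and> (\<gamma>, Y) \<in> possible_futures q \<and> \<alpha> \<in> shuffles \<beta> \<gamma>}"
  (is "_ = ?R")
proof (intro set_eqI iffI)
  fix \<phi> assume "\<phi> \<in> possible_futures (p \<parallel> q)"
  then obtain \<alpha> \<beta> \<gamma> p' q' where *: "\<phi> = (\<alpha>, traces (p' \<parallel> q'))" "path p \<beta> p'" "path q \<gamma> q'"
    "\<alpha> \<in> shuffles \<beta> \<gamma>"
    unfolding possible_futures_def path_Par_iff by blast
  moreover from this have "(\<beta>, traces p') \<in> possible_futures p" "(\<gamma>, traces q') \<in> possible_futures q"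
    unfolding possible_futures_def by blast+
  ultimately show "\<phi> \<in> ?R" by (auto simp: traces_Par)
next
  fix \<phi> assume "\<phi> \<in> ?R"
  then obtain \<alpha> \<beta> \<gamma> p' q' where "\<phi> = (\<alpha>, traces (p' \<parallel> q'))" "path p \<beta> p'" "path q \<gamma> q'"
    "\<alpha> \<in> shuffles \<beta> \<gamma>"
    by (auto simp: possible_futures_def traces_Par)
  then show "\<phi> \<in> possible_futures (p \<parallel> q)"
    unfolding possible_futures_def path_Par_iff by blast
qed

lemma possible_futures_Par_commute: "possible_futures (p \<parallel> q) = possible_futures (q \<parallel> p)"
proof -
  have "possible_futures (p \<parallel> q) \<subseteq> possible_futures (q \<parallel> p)" for p q :: "('a, 'v) trm"
  proof
    fix \<phi> assume "\<phi> \<in> possible_futures (p \<parallel> q)"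
    then obtain \<alpha> \<beta> \<gamma> p' q' where *: "\<phi> = (\<alpha>, traces (p' \<parallel> q'))" "path p \<beta> p'" "path q \<gamma> q'"
      "\<alpha> \<in> shuffles \<beta> \<gamma>"
      by (auto simp: possible_futures_def path_Par_iff)
    have "traces (p' \<parallel> q') = traces (q' \<parallel> p')"
      by (auto simp: traces_Par) (metis shuffles_commutes)+
    moreover have "path (q \<parallel> p) \<alpha> (q' \<parallel> p')"
      unfolding path_Par_iff using * shuffles_commutes by blast
    ultimately show "\<phi> \<in> possible_futures (q \<parallel> p)"
      using * by (auto simp: possible_futures_def)
  qed
  then show ?thesis by blast
qed

text \<open>Leaving out the empty word makes \<open>futures\<close> additive on sums and loses no information.\<close>

definition futures :: "('a, 'v) trm \<Rightarrow> ('a list \<times> 'a list set) set" where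
  "futures p = {(\<alpha>, traces p') | \<alpha> p'. path p \<alpha> p' \<and> \<alpha> \<noteq> []}"

lemma possible_futures_eq: "possible_futures p = insert ([], traces p) (futures p)"
  unfolding possible_futures_def futures_def by (auto, (metis path_Nil_iff)+)

lemma traces_eq: "traces p = insert [] (fst ` futures p)"
proof -
  have "\<alpha> \<in> fst ` futures p" if "path p \<alpha> p'" "\<alpha> \<noteq> []" for \<alpha> p'
    using that by (auto simp: futures_def image_iff)
  then show ?thesis
    by (auto simp: traces_def futures_def)
qed

lemma futures_eq: "futures p = possible_futures p \<inter> {(\<alpha>, X). \<alpha> \<noteq> []}"
  unfolding possible_futures_def futures_def by auto

text \<open>The dropped entry \<open>([], traces p)\<close> can be recovered: by
  \<open>traces_eq\<close> the nonempty traces are the first components of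
  \<open>futures p\<close>.\<close>

lemma possible_futures_eq_iff: "possible_futures p = possible_futures q \<longleftrightarrow> futures p = futures q"
proof
  assume "futures p = futures q"
  then show "possible_futures p = possible_futures q"
    by (simp add: possible_futures_eq traces_eq[of p] traces_eq[of q])
qed (simp add: futures_eq)

lemma pf_equiv_iff: "pf_equiv p q \<longleftrightarrow> futures p = futures q"
  by (simp add: pf_equiv_def possible_futures_eq_iff)

lemma futures_subset_traces: "futures p \<subseteq> futures q \<Longrightarrow> traces p \<subseteq> traces q"
  by (auto simp: traces_eq)

lemma futures_memI: "path p \<alpha> p' \<Longrightarrow> \<alpha> \<noteq> [] \<Longrightarrow> (\<alpha>, traces p') \<in> futures p"
  unfolding futures_def by auto

lemma futures_memE:
  assumes "(\<alpha>, X) \<in> futures p"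
  obtains p' where "path p \<alpha> p'" "X = traces p'" "\<alpha> \<noteq> []"
  using assms unfolding futures_def by auto

lemma futures_Zero [simp]: "futures Zero = {}"
  by (auto simp: futures_def)

lemma futures_Sum [simp]: "futures (p \<oplus> q) = futures p \<union> futures q"
  unfolding futures_def by (auto simp: neq_Nil_conv) (auto simp: path_Cons_iff)

lemma futures_Pre: "futures (Pre c p) = (\<lambda>(\<alpha>, X). (c # \<alpha>, X)) ` possible_futures p"
proof -
  have "path (Pre c p) \<alpha> r \<and> \<alpha> \<noteq> [] \<longleftrightarrow> (\<exists>\<beta>. \<alpha> = c # \<beta> \<and> path p \<beta> r)" for \<alpha> r
    by (cases \<alpha>) (auto simp: path_Cons_iff)
  then show ?thesis
    by (auto simp: futures_def possible_futures_def image_iff)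
qed

lemma futures_Pre_cong: "futures p = futures q \<Longrightarrow> futures (Pre c p) = futures (Pre c q)"
  by (simp add: futures_Pre flip: possible_futures_eq_iff)

lemma futures_Par_cong:
  "futures p = futures q \<Longrightarrow> futures p' = futures q' \<Longrightarrow> futures (p \<parallel> p') = futures (q \<parallel> q')"
  by (simp add: possible_futures_Par flip: possible_futures_eq_iff)

lemma futures_Par_commute: "futures (p \<parallel> q) = futures (q \<parallel> p)"
  by (simp add: possible_futures_Par_commute flip: possible_futures_eq_iff)

section \<open>Depth and trivial processes\<close>

text \<open>By \<open>traces_length\<close> and \<open>longest_path\<close> this syntactic number is
  the length of a longest trace, hence invariant under equivalence. \<open>depth p = 0\<close>
  serves as the test for a trivial process, one equivalent to \<open>Zero\<close>.\<close>

primrec depth :: "('a, 'v) trm \<Rightarrow> nat" where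
  "depth Zero = 0"
| "depth (Var x) = 0"
| "depth (Pre c t) = Suc (depth t)"
| "depth (t \<oplus> u) = max (depth t) (depth u)"
| "depth (t \<parallel> u) = depth t + depth u"

lemma step_depth: "step p c p' \<Longrightarrow> depth p' < depth p"
  by (induction rule: step.induct) auto

lemma path_depth: "path p \<alpha> p' \<Longrightarrow> length \<alpha> + depth p' \<le> depth p"
  by (induction rule: path.induct) (auto dest: step_depth)

lemma ex_step_depth: "depth p = Suc n \<Longrightarrow> \<exists>c p'. step p c p' \<and> depth p' = n"
proof (induction p arbitrary: n)
  case (Sum p q)
  then show ?case by (auto simp: max_def split: if_splits)
next
  case (Par p q)
  show ?case
  proof (cases "depth p")
    case 0
    with Par.prems obtain c q' where "step q c q'" "depth q' = n" using Par.IH(2)[of n] by auto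
    then show ?thesis using 0 by (intro exI[of _ c] exI[of _ "p \<parallel> q'"]) (auto simp: step_Par_iff)
  next
    case (Suc m)
    with Par.prems obtain c p' where "step p c p'" "depth p' = m" using Par.IH(1)[of m] by auto
    then show ?thesis using Suc Par.prems
      by (intro exI[of _ c] exI[of _ "p' \<parallel> q"]) (auto simp: step_Par_iff)
  qed
qed auto

text \<open>The end point has depth 0, so the word is a completed trace; the primality argument for
  \<open>pN\<close> interleaves two such words.\<close>

lemma longest_path:
  obtains \<alpha> p' where "path p \<alpha> p'" "length \<alpha> = depth p" "depth p' = 0"
proof -
  have "\<exists>\<alpha> p'. path p \<alpha> p' \<and> length \<alpha> = depth p \<and> depth p' = 0"
  proof (induction "depth p" arbitrary: p)
    case 0
    then show ?case by (intro exI[of _ "[]"] exI[of _ p]) auto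
  next
    case (Suc n)
    then obtain c s where s: "step p c s" "depth s = n" using ex_step_depth by metis
    with Suc.hyps(1)[of s] obtain \<alpha> p' where "path s \<alpha> p'" "length \<alpha> = n" "depth p' = 0" by auto
    with s Suc.hyps(2) show ?case
      by (intro exI[of _ "c # \<alpha>"] exI[of _ p']) (auto simp: path_Cons_iff)
  qed
  then show ?thesis using that by blast
qed

lemma traces_length: "\<alpha> \<in> traces p \<Longrightarrow> length \<alpha> \<le> depth p"
  using path_depth by (fastforce simp: traces_def)

lemma depth_mono:
  assumes "traces p \<subseteq> traces q"
  shows "depth p \<le> depth q"
proof -
  obtain \<alpha> p' where "path p \<alpha> p'" "length \<alpha> = depth p" by (rule longest_path)
  then have "\<alpha> \<in> traces q" using assms by (auto simp: traces_def)
  then show ?thesis using \<open>length \<alpha> = depth p\<close> traces_length by fastforce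
qed

lemma depth_cong: "traces p = traces q \<Longrightarrow> depth p = depth q"
  by (simp add: depth_mono order_antisym)

lemma traces_eq_Nil_iff: "traces p = {[]} \<longleftrightarrow> depth p = 0"
proof
  assume "traces p = {[]}"
  then show "depth p = 0" using depth_mono[of p "Zero"] by simp
next
  assume "depth p = 0"
  then show "traces p = {[]}" using traces_length[of _ p] by auto
qed

lemma futures_eq_empty_iff: "futures p = {} \<longleftrightarrow> depth p = 0"
proof -
  have "[] \<notin> fst ` futures p" by (auto simp: futures_def)
  then have "traces p = {[]} \<longleftrightarrow> futures p = {}" by (force simp: traces_eq)
  then show ?thesis by (simp add: traces_eq_Nil_iff)
qed

lemma possible_futures_Par_zero:
  assumes "depth q = 0"
  shows "possible_futures (p \<parallel> q) = possible_futures p"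
proof -
  have "futures q = {}" using assms by (simp add: futures_eq_empty_iff)
  then have "possible_futures q = {([], {[]})}" "traces q = {[]}"
    by (auto simp: possible_futures_eq traces_eq)
  then show ?thesis by (auto simp: possible_futures_Par) 
qed

lemma futures_Par_zero:
  assumes "depth q = 0"
  shows "futures (p \<parallel> q) = futures p" "futures (q \<parallel> p) = futures p"
  using possible_futures_Par_zero[OF assms, of p] futures_Par_commute[of q p]
  by (simp_all add: futures_eq)

section \<open>The processes \<open>bpow b a i\<close> and their sum \<open>pN a b N\<close>\<close>

lemma path_bpow_iff:
  "path (bpow b a i) \<alpha> r \<longleftrightarrow>
     (\<exists>k \<le> i. \<alpha> = replicate k b \<and> r = bpow b a (i - k)) \<or> \<alpha> = replicate i b @ [a] \<and> r = Zero"
proof (induction i arbitrary: \<alpha>)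
  case 0
  show ?case by (cases \<alpha>) (auto simp: path_Cons_iff)
next
  case (Suc i)
  show ?case
  proof (cases \<alpha>)
    case Nil
    then show ?thesis by auto
  next
    case (Cons c \<beta>)
    have "(\<exists>k \<le> Suc i. c # \<beta> = replicate k b \<and> r = bpow b a (Suc i - k)) \<longleftrightarrow>
       c = b \<and> (\<exists>k \<le> i. \<beta> = replicate k b \<and> r = bpow b a (i - k))" (is "?L = ?R")
    proof
      assume ?L
      then obtain k where "k \<le> Suc i" "c # \<beta> = replicate k b" "r = bpow b a (Suc i - k)" by blast
      then show ?R by (cases k) auto
    next
      assume ?R
      then obtain k where "c = b" "k \<le> i" "\<beta> = replicate k b" "r = bpow b a (i - k)" by blast
      then show ?L by (intro exI[of _ "Suc k"]) auto
    qed
    with Cons Suc show ?thesis by (auto simp: path_Cons_iff)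
  qed
qed

lemma depth_bpow [simp]: "depth (bpow b a i) = Suc i"
  by (induction i) auto

lemma traces_bpow: "traces (bpow b a i) = (\<lambda>k. replicate k b) ` {..i} \<union> {replicate i b @ [a]}"
  by (auto simp: traces_def path_bpow_iff)

lemma futures_bpow:
  "futures (bpow b a i :: ('a, 'v) trm) =
     (\<lambda>k. (replicate k b, traces (bpow b a (i - k) :: ('a, 'v) trm))) ` {1..i} \<union> {(replicate i b @ [a], {[]})}"
proof -
  have "traces (Zero :: ('a, 'v) trm) = {[]}" by (simp add: traces_eq_Nil_iff)
  moreover have "{(\<alpha>, r). path (bpow b a i :: ('a, 'v) trm) \<alpha> r \<and> \<alpha> \<noteq> []} =
      (\<lambda>k. (replicate k b, bpow b a (i - k))) ` {1..i} \<union> {(replicate i b @ [a], Zero)}"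
    by (auto simp: path_bpow_iff image_iff Suc_le_eq)
  moreover have "futures (bpow b a i :: ('a, 'v) trm) =
      (\<lambda>(\<alpha>, r). (\<alpha>, traces r)) ` {(\<alpha>, r). path (bpow b a i :: ('a, 'v) trm) \<alpha> r \<and> \<alpha> \<noteq> []}"
    by (auto simp: futures_def image_iff)
  ultimately show ?thesis by (simp add: image_Un image_image)
qed

lemma replicate_neq_snoc:
  assumes "a \<noteq> b"
  shows "replicate k b \<noteq> \<beta> @ [a]"
proof
  assume "replicate k b = \<beta> @ [a]"
  then have "a \<in> set (replicate k b)" by simp
  then show False using assms by simp
qed

text \<open>The final \<open>a\<close> marks where the b's stop, so this single word pins down the
  exponent.\<close>

lemma replicate_snoc_in_traces_bpow:
  "a \<noteq> b \<Longrightarrow> replicate j b @ [a] \<in> traces (bpow b a i) \<longleftrightarrow> i = j"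
  using replicate_neq_snoc[of a b] by (auto simp: traces_bpow) metis+

lemma futures_pN:
  "futures (pN a b N :: ('a, 'v) trm) = (\<Union>i \<in> {1..N}. futures (bpow b a i :: ('a, 'v) trm))"
proof (induction a b N rule: pN.induct)
  case (3 a b n)
  have "{1..Suc (Suc n)} = insert (Suc (Suc n)) {1..Suc n}" by auto
  with 3 show ?case by auto
qed auto

lemma traces_pN:
  assumes "a \<noteq> b"
  shows "replicate i b @ [a] \<in> traces (pN a b N :: ('a, 'v) trm) \<longleftrightarrow> i \<in> {1..N}"
proof -
  have "replicate i b @ [a] \<in> traces (pN a b N :: ('a, 'v) trm) \<longleftrightarrow>
      (\<exists>j \<in> {1..N}. replicate i b @ [a] \<in> traces (bpow b a j :: ('a, 'v) trm))"
    by (auto simp: traces_eq futures_pN)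
  then show ?thesis using assms by (auto simp: replicate_snoc_in_traces_bpow)
qed

lemma futures_pN_cases:
  assumes "(\<alpha>, X) \<in> futures (pN a b N :: ('a, 'v) trm)"
  obtains i k where "1 \<le> k" "k \<le> i" "i \<le> N" "\<alpha> = replicate k b"
      "X = traces (bpow b a (i - k) :: ('a, 'v) trm)"
    | i where "1 \<le> i" "i \<le> N" "\<alpha> = replicate i b @ [a]" "X = {[]}"
  using assms by (auto simp: futures_pN futures_bpow)

lemma futures_pN_hd: "(c # \<alpha>, X) \<in> futures (pN a b N) \<Longrightarrow> c = b"
  by (erule futures_pN_cases) (auto simp: Cons_replicate_eq Cons_eq_append_conv)

text \<open>The trace set \<open>{[]}\<close> signals termination, whereas after b's alone some
  \<open>bpow\<close> of positive depth is left.\<close>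

lemma futures_pN_completed:
  assumes "(\<alpha>, {[]}) \<in> futures (pN a b N)"
  obtains i where "1 \<le> i" "i \<le> N" "\<alpha> = replicate i b @ [a]"
  using assms
proof (cases rule: futures_pN_cases)
  case (1 i k)
  then show ?thesis using traces_eq_Nil_iff[of "bpow b a (i - k)"] by auto
qed (use that in auto)

section \<open>Parallel primality of \<open>pN\<close> and decompositions of
  \<open>a \<parallel> p\<^sub>N\<close>\<close>

lemma append_eq_replicate_snoc:
  assumes "\<beta> @ \<gamma> = replicate i b @ [a]" "\<gamma> \<noteq> []"
  shows "set \<beta> \<subseteq> {b}" "last \<gamma> = a"
proof -
  have "butlast (\<beta> @ \<gamma>) = replicate i b" "last (\<beta> @ \<gamma>) = a" using assms(1) by simp_all
  then have *: "\<beta> @ butlast \<gamma> = replicate i b" "last \<gamma> = a" using assms(2) by (auto simp: butlast_append)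
  have "set \<beta> \<subseteq> set (\<beta> @ butlast \<gamma>)" by simp
  then show "set \<beta> \<subseteq> {b}" unfolding *(1) by (auto split: if_splits)
  show "last \<gamma> = a" by (fact *(2))
qed

lemma append_in_shuffles: "\<beta> @ \<gamma> \<in> shuffles \<beta> \<gamma>"
  by (induction \<beta>) (auto simp: Cons_in_shuffles_iff)

lemma append_in_shuffles': "\<gamma> @ \<beta> \<in> shuffles \<beta> \<gamma>"
  using append_in_shuffles shuffles_commutes by blast

text \<open>Every completed trace of \<open>pN a b N\<close> contains exactly one \<open>a\<close>, at its end, whereas two
  nontrivial parallel components can be completed in either order.\<close>

lemma pN_parallel_prime:
  fixes p q :: "('a, 'v) trm"
  assumes "a \<noteq> b" and sub: "futures (p \<parallel> q) \<subseteq> futures (pN a b N :: ('a, 'v) trm)"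
  shows "depth p = 0 \<or> depth q = 0"
proof (rule ccontr)
  assume nz: "\<not> (depth p = 0 \<or> depth q = 0)"
  obtain \<beta> p' where \<beta>: "path p \<beta> p'" "length \<beta> = depth p" "depth p' = 0" by (rule longest_path)
  obtain \<gamma> q' where \<gamma>: "path q \<gamma> q'" "length \<gamma> = depth q" "depth q' = 0" by (rule longest_path)
  have ne: "\<beta> \<noteq> []" "\<gamma> \<noteq> []" using nz \<beta>(2) \<gamma>(2) by auto
  have "traces (p' \<parallel> q') = {[]}" using \<beta>(3) \<gamma>(3) by (simp add: traces_eq_Nil_iff)
  moreover have "path (p \<parallel> q) \<alpha> (p' \<parallel> q')" if "\<alpha> \<in> shuffles \<beta> \<gamma>" for \<alpha>
    unfolding path_Par_iff using that \<beta>(1) \<gamma>(1) by blast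
  moreover have "\<alpha> \<noteq> []" if "\<alpha> \<in> shuffles \<beta> \<gamma>" for \<alpha>
    using that ne by auto
  ultimately have completed: "(\<alpha>, {[]}) \<in> futures (pN a b N :: ('a, 'v) trm)"
    if "\<alpha> \<in> shuffles \<beta> \<gamma>" for \<alpha>
    using that futures_memI[of "p \<parallel> q" \<alpha> "p' \<parallel> q'"] sub by auto
  \<comment> \<open>With \<beta> first, \<beta> consists of b's only; in the opposite order \<beta>
    must end in \<open>a\<close>.\<close>
  obtain i where i: "\<beta> @ \<gamma> = replicate i b @ [a]"
    using completed[OF append_in_shuffles] by (rule futures_pN_completed)
  obtain j where j: "\<gamma> @ \<beta> = replicate j b @ [a]"
    using completed[OF append_in_shuffles'] by (rule futures_pN_completed)
  have "last \<beta> = a" "set \<beta> \<subseteq> {b}"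
    using append_eq_replicate_snoc[OF i ne(2)] append_eq_replicate_snoc[OF j ne(1)] by auto
  then show False using ne \<open>a \<noteq> b\<close> last_in_set by fastforce
qed

text \<open>Since \<open>pN\<close> starts only with \<open>b\<close>, an initial \<open>a\<close>
  must consume the left factor and leave \<open>pN\<close> untouched.\<close>

lemma futures_a_pN_hd:
  assumes "a \<noteq> b" "(a # \<alpha>, X) \<in> futures (Pre a Zero \<parallel> pN a b N :: ('a, 'v) trm)"
  shows "(\<alpha>, X) \<in> possible_futures (pN a b N :: ('a, 'v) trm)"
proof -
  let ?p = "pN a b N :: ('a, 'v) trm"
  from assms(2) obtain r where r: "path (Pre a Zero \<parallel> ?p) (a # \<alpha>) r" "X = traces r"
    by (auto elim: futures_memE)
  have "\<not> step ?p a q'" for q'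
    using futures_memI[of ?p "[a]" q'] futures_pN_hd[of a "[]" _ a b N] \<open>a \<noteq> b\<close>
    by (auto simp: path_Cons_iff)
  then have "path (Zero \<parallel> ?p) \<alpha> r" using r(1) by (auto simp: path_Cons_iff step_Par_iff)
  then have "(\<alpha>, X) \<in> possible_futures (Zero \<parallel> ?p)"
    using r(2) by (auto simp: possible_futures_def)
  then show ?thesis
    by (simp add: possible_futures_Par_commute[of Zero] possible_futures_Par_zero)
qed

text \<open>A trace of \<open>pN\<close> has at most \<open>N\<close> letters other than
  \<open>a\<close>, and the factor \<open>a\<close> adds none. This later excludes any initial
  action other than \<open>a\<close> in the first component of a decomposition.\<close>

lemma traces_a_pN_bs:
  assumes "a \<noteq> b" "\<alpha> \<in> traces (Pre a Zero \<parallel> pN a b N :: ('a, 'v) trm)"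
  shows "length (filter (\<lambda>c. c \<noteq> a) \<alpha>) \<le> N"
proof -
  from assms(2) obtain \<beta> \<gamma> where *: "\<beta> \<in> traces (Pre a Zero :: ('a, 'v) trm)" "\<gamma> \<in> traces (pN a b N :: ('a, 'v) trm)"
    "\<alpha> \<in> shuffles \<beta> \<gamma>" by (auto simp: traces_Par)
  from *(1) have "filter (\<lambda>c. c \<noteq> a) \<beta> = []"
    by (cases \<beta>) (auto simp: traces_def path_Cons_iff)
  moreover have "length (filter (\<lambda>c. c \<noteq> a) \<gamma>) \<le> N"
  proof (cases "\<gamma> = []")
    case False
    then obtain X where "(\<gamma>, X) \<in> futures (pN a b N :: ('a, 'v) trm)" using *(2) by (auto simp: traces_eq)
    then show ?thesis by (cases rule: futures_pN_cases) (use \<open>a \<noteq> b\<close> in auto)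
  qed auto
  moreover have "filter (\<lambda>c. c \<noteq> a) \<alpha> \<in> shuffles (filter (\<lambda>c. c \<noteq> a) \<beta>) (filter (\<lambda>c. c \<noteq> a) \<gamma>)"
    using *(3) filter_shuffles by blast
  ultimately show ?thesis by (auto)
qed

text \<open>To find in \<open>q\<close> the future after b^k on the way to b^i a, follow a path of
  \<open>q\<close> along b^i a and stop after \<open>k\<close> letters. By inclusion the traces
  there are those of some \<open>bpow b a j\<close>, and the remaining word b^(i-k) a forces j = i -
  k.\<close>

lemma futures_eq_pN:
  fixes q :: "('a, 'v) trm"
  assumes "a \<noteq> b" and sub: "futures q \<subseteq> futures (pN a b N :: ('a, 'v) trm)" and tr: "traces q = traces (pN a b N :: ('a, 'v) trm)"
  shows "futures q = futures (pN a b N :: ('a, 'v) trm)"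
proof (intro equalityI sub subsetI)
  have completed: "X = {[]}" if "(replicate i b @ [a], X) \<in> futures (pN a b N :: ('a, 'v) trm)" for i X
    using that
  proof (cases rule: futures_pN_cases)
    case (1 i' k)
    then show ?thesis using replicate_neq_snoc[OF \<open>a \<noteq> b\<close>, of k "replicate i b"] by simp
  qed
  fix \<phi> assume "\<phi> \<in> futures (pN a b N :: ('a, 'v) trm)"
  moreover obtain \<alpha> X where \<phi>: "\<phi> = (\<alpha>, X)" by fastforce
  ultimately have "(\<alpha>, X) \<in> futures (pN a b N :: ('a, 'v) trm)" by simp
  then show "\<phi> \<in> futures q"
  proof (cases rule: futures_pN_cases)
    case (1 i k)
    then have "replicate k b @ replicate (i - k) b @ [a] \<in> traces q"
      using tr traces_pN[OF \<open>a \<noteq> b\<close>, of i N, where ?'v = 'v] by (simp flip: append_assoc replicate_add)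
    then obtain s r where s: "path q (replicate k b) s" "path s (replicate (i - k) b @ [a]) r"
      by (auto simp: traces_def path_append_iff[of q])
    with 1 sub have "(replicate k b, traces s) \<in> futures (pN a b N :: ('a, 'v) trm)"
      using futures_memI by fastforce
    then obtain j where "traces s = traces (bpow b a j :: ('a, 'v) trm)"
      using replicate_neq_snoc[OF \<open>a \<noteq> b\<close>] by (cases rule: futures_pN_cases) auto
    moreover have "replicate (i - k) b @ [a] \<in> traces s" using s(2) by (auto simp: traces_def)
    ultimately have "traces s = X" using 1 \<open>a \<noteq> b\<close> by (simp add: replicate_snoc_in_traces_bpow)
    then show ?thesis using s(1) 1 \<phi> futures_memI by fastforce
  next
    case (2 i)
    then have "\<alpha> \<in> traces q" using tr traces_pN[OF \<open>a \<noteq> b\<close>, of i N, where ?'v = 'v] by simp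
    then obtain s where s: "path q \<alpha> s" by (auto simp: traces_def)
    with 2 have "(\<alpha>, traces s) \<in> futures q" using futures_memI by blast
    moreover from this have "traces s = {[]}" using completed 2 sub by blast
    ultimately show ?thesis using \<phi> 2 by simp
  qed
qed

text \<open>After its \<open>a\<close>, the component \<open>p\<close> becomes some
  \<open>p'\<close> with \<open>p' \<parallel> q\<close> below \<open>pN\<close>. Primality makes
  \<open>p'\<close> trivial, so \<open>q\<close> lies below \<open>pN\<close>; what is left for
  \<open>p\<close> is a single action, which a count of non-\<open>a\<close> letters
  identifies.\<close>

lemma decompose_a_pN:
  fixes p q :: "('a, 'v) trm"
  assumes "a \<noteq> b" "N > 0"
    and sub: "futures (p \<parallel> q) \<subseteq> futures (Pre a Zero \<parallel> pN a b N :: ('a, 'v) trm)"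
    and nz: "depth p > 0" "depth q > 0"
    and a: "[a] \<in> traces p"
  shows "futures p = futures (Pre a Zero :: ('a, 'v) trm)" "futures q = futures (pN a b N :: ('a, 'v) trm)"
proof -
  from a obtain p' where p': "step p a p'" by (auto simp: traces_def path_Cons_iff)
  have after_a: "possible_futures (p' \<parallel> q) \<subseteq> possible_futures (pN a b N :: ('a, 'v) trm)"
  proof
    fix \<phi> assume "\<phi> \<in> possible_futures (p' \<parallel> q)"
    then obtain \<alpha> r where r: "\<phi> = (\<alpha>, traces r)" "path (p' \<parallel> q) \<alpha> r"
      by (auto simp: possible_futures_def)
    then have "path (p \<parallel> q) (a # \<alpha>) r" using p' by (auto simp: path_Cons_iff step_Par_iff)
    then have "(a # \<alpha>, traces r) \<in> futures (Pre a Zero \<parallel> pN a b N :: ('a, 'v) trm)"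
      using sub futures_memI by blast
    then show "\<phi> \<in> possible_futures (pN a b N :: ('a, 'v) trm)"
      using futures_a_pN_hd[OF \<open>a \<noteq> b\<close>] r(1) by blast
  qed
  then have "futures (p' \<parallel> q) \<subseteq> futures (pN a b N :: ('a, 'v) trm)" by (auto simp: futures_eq)
  then have "depth p' = 0" using pN_parallel_prime[OF \<open>a \<noteq> b\<close>] nz(2) by fastforce
  then have pf: "possible_futures q \<subseteq> possible_futures (pN a b N :: ('a, 'v) trm)"
    using after_a by (simp add: possible_futures_Par_zero possible_futures_Par_commute[of p'])
  then have fut: "futures q \<subseteq> futures (pN a b N :: ('a, 'v) trm)" by (auto simp: futures_eq)
  \<comment> \<open>The empty word has only one entry in \<open>possible_futures\<close>, the full
    trace set, so this gives equality of traces and not only inclusion.\<close>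
  have "([], traces q) \<in> possible_futures (pN a b N :: ('a, 'v) trm)" using pf by (auto simp: possible_futures_eq)
  then have tr: "traces q = traces (pN a b N :: ('a, 'v) trm)"
    by (auto simp: possible_futures_eq futures_def)
  show "futures q = futures (pN a b N :: ('a, 'v) trm)"
    using futures_eq_pN[OF \<open>a \<noteq> b\<close> fut tr] .
  have "depth (p \<parallel> q) \<le> depth (Pre a Zero \<parallel> pN a b N :: ('a, 'v) trm)"
    by (intro depth_mono futures_subset_traces sub)
  \<comment> \<open>The whole has depth at most 1 plus that of \<open>pN\<close>, and
    \<open>q\<close> already uses the latter.\<close>
  then have "depth p = 1"
    using depth_cong[OF tr] nz(1) by simp
  have only_a: "c = a \<and> depth s = 0" if "step p c s" for c s
  proof
    \<comment> \<open>\<open>q\<close> alone performs \<open>N\<close> b's, so a first letter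
      \<open>c\<close> other than \<open>a\<close> would make \<open>N + 1\<close> letters different
      from \<open>a\<close>.\<close>
    obtain d where d: "path q (replicate N b @ [a]) d"
      using traces_pN[OF \<open>a \<noteq> b\<close>, of N N] tr \<open>N > 0\<close> by (auto simp: traces_def)
    have "path p [c] s" using that by (auto simp: path_Cons_iff)
    with d have "path (p \<parallel> q) ([c] @ replicate N b @ [a]) (s \<parallel> d)"
      unfolding path_Par_iff using append_in_shuffles by blast
    then have "[c] @ replicate N b @ [a] \<in> traces (Pre a Zero \<parallel> pN a b N :: ('a, 'v) trm)"
      using futures_subset_traces[OF sub] by (auto simp: traces_def)
    from traces_a_pN_bs[OF \<open>a \<noteq> b\<close> this] show "c = a" using \<open>a \<noteq> b\<close> by (auto split: if_splits)
    show "depth s = 0" using step_depth[OF that] \<open>depth p = 1\<close> by simp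
  qed
  have path_p: "path p \<alpha> r \<and> \<alpha> \<noteq> [] \<longleftrightarrow> \<alpha> = [a] \<and> step p a r" for \<alpha> r
  proof
    assume *: "path p \<alpha> r \<and> \<alpha> \<noteq> []"
    then obtain c \<beta> s where "\<alpha> = c # \<beta>" "step p c s" "path s \<beta> r"
      by (cases \<alpha>) (auto simp: path_Cons_iff)
    then show "\<alpha> = [a] \<and> step p a r" using only_a[of c s] path_depth[of s \<beta> r] by auto
  qed (auto simp: path_Cons_iff)
  have "futures p = {([a], {[]})}"
  proof -
    have "traces r = {[]}" if "step p a r" for r
      using only_a[OF that] by (simp add: traces_eq_Nil_iff)
    then show ?thesis unfolding futures_def path_p using p' by blast
  qed
  moreover have "futures (Pre a Zero :: ('a, 'v) trm) = {([a], {[]})}"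
    by (auto simp: futures_Pre possible_futures_eq traces_eq_Nil_iff)
  ultimately show "futures p = futures (Pre a Zero :: ('a, 'v) trm)" by simp
qed

section \<open>Initial actions and actions occurring in traces\<close>

lemma traces_subset_Par: "traces p \<subseteq> traces (p \<parallel> q)" "traces q \<subseteq> traces (p \<parallel> q)"
proof -
  have "\<alpha> \<in> traces (p \<parallel> q)" if "\<alpha> \<in> traces p" for \<alpha>
    using that unfolding traces_Par by (intro UN_I[of \<alpha>] UN_I[of "[]"]) auto
  moreover have "\<alpha> \<in> traces (p \<parallel> q)" if "\<alpha> \<in> traces q" for \<alpha>
    using that unfolding traces_Par by (intro UN_I[of "[]"] UN_I[of \<alpha>]) auto
  ultimately show "traces p \<subseteq> traces (p \<parallel> q)" "traces q \<subseteq> traces (p \<parallel> q)" by blast+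
qed

lemma singleton_in_traces_iff: "[c] \<in> traces p \<longleftrightarrow> (\<exists>r. step p c r)"
  by (auto simp: traces_def path_Cons_iff)

lemma singleton_in_traces_Par: "[c] \<in> traces (p \<parallel> q) \<longleftrightarrow> [c] \<in> traces p \<or> [c] \<in> traces q"
  by (auto simp: singleton_in_traces_iff step_Par_iff)

lemma singleton_in_traces_depth: "[c] \<in> traces p \<Longrightarrow> depth p > 0"
  by (auto dest: traces_length)

text \<open>Coarser than \<open>traces\<close>, but it turns parallel composition into union, which
  suffices to locate an action in one of the components.\<close>

definition trace_acts :: "('a, 'v) trm \<Rightarrow> 'a set" where
  "trace_acts p = (\<Union>\<alpha> \<in> traces p. set \<alpha>)"

lemma trace_acts_Par: "trace_acts (p \<parallel> q) = trace_acts p \<union> trace_acts q"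
proof
  show "trace_acts (p \<parallel> q) \<subseteq> trace_acts p \<union> trace_acts q"
  proof
    fix c assume "c \<in> trace_acts (p \<parallel> q)"
    then obtain \<alpha> \<beta> \<gamma> where *: "c \<in> set \<alpha>" "\<beta> \<in> traces p" "\<gamma> \<in> traces q" "\<alpha> \<in> shuffles \<beta> \<gamma>"
      unfolding trace_acts_def traces_Par by blast
    then have "c \<in> set \<beta> \<union> set \<gamma>" using set_shuffles by fastforce
    with * show "c \<in> trace_acts p \<union> trace_acts q" by (auto simp: trace_acts_def)
  qed
  show "trace_acts p \<union> trace_acts q \<subseteq> trace_acts (p \<parallel> q)"
    unfolding trace_acts_def by (intro Un_least UN_mono traces_subset_Par order_refl)
qed

lemma trace_acts_Zero [simp]: "trace_acts Zero = {}"
  by (auto simp: trace_acts_def traces_def)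

section \<open>Substitution instances and their heads\<close>

lemma depth_tsubst_vars: "x \<in> vars t \<Longrightarrow> depth (\<sigma> x) \<le> depth (tsubst \<sigma> t)"
  by (induction t) (auto simp: le_max_iff_disj intro: trans_le_add1 trans_le_add2)

lemma tsubst_cong: "(\<And>x. x \<in> vars t \<Longrightarrow> \<sigma> x = \<tau> x) \<Longrightarrow> tsubst \<sigma> t = tsubst \<tau> t"
  by (induction t) auto

lemma depth_tsubst_zero_cong:
  assumes "\<And>x. depth (\<sigma> x) = 0 \<longleftrightarrow> depth (\<tau> x) = 0"
  shows "depth (tsubst \<sigma> t) = 0 \<longleftrightarrow> depth (tsubst \<tau> t) = 0"
  using assms by (induction t) auto

text \<open>Heads are kept as open terms, so that a variable among them can be given another value
  later. A head \<open>t \<parallel> u\<close> always has two nontrivial factors under \<sigma>; a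
  variable head may be trivial.\<close>

primrec heads :: "('v \<Rightarrow> ('a, 'w) trm) \<Rightarrow> ('a, 'v) trm \<Rightarrow> ('a, 'v) trm set" where
  "heads \<sigma> Zero = {Zero}"
| "heads \<sigma> (Var x) = {Var x}"
| "heads \<sigma> (Pre c t) = {Pre c t}"
| "heads \<sigma> (t \<oplus> u) = heads \<sigma> t \<union> heads \<sigma> u"
| "heads \<sigma> (t \<parallel> u) =
     (if depth (tsubst \<sigma> u) = 0 then heads \<sigma> t else {}) \<union>
     (if depth (tsubst \<sigma> t) = 0 then heads \<sigma> u else {}) \<union>
     (if depth (tsubst \<sigma> t) \<noteq> 0 \<and> depth (tsubst \<sigma> u) \<noteq> 0 then {t \<parallel> u} else {})"

text \<open>\<open>heads\<close> consults \<sigma> only to see which subterms become trivial. Hence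
  one nontrivial value may be exchanged for another without changing any heads.\<close>

lemma heads_cong:
  assumes "\<And>x. depth (\<sigma> x) = 0 \<longleftrightarrow> depth (\<tau> x) = 0"
  shows "heads \<sigma> t = heads \<tau> t"
proof (induction t)
  case (Par t u)
  then show ?case
    using depth_tsubst_zero_cong[of \<sigma> \<tau> t, OF assms] depth_tsubst_zero_cong[of \<sigma> \<tau> u, OF assms] by simp
qed auto

lemma futures_heads: "futures (tsubst \<sigma> t) = (\<Union>v \<in> heads \<sigma> t. futures (tsubst \<sigma> v))"
proof (induction t)
  case (Par t u)
  show ?case
  proof (cases "depth (tsubst \<sigma> t) = 0 \<or> depth (tsubst \<sigma> u) = 0")
    case True
    then show ?thesis
      using Par futures_eq_empty_iff[of "tsubst \<sigma> t"] futures_eq_empty_iff[of "tsubst \<sigma> u"]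
      by (auto simp: futures_Par_zero)
  qed simp
qed auto

lemma futures_head_subset: "v \<in> heads \<sigma> t \<Longrightarrow> futures (tsubst \<sigma> v) \<subseteq> futures (tsubst \<sigma> t)"
  by (subst (2) futures_heads) blast

lemma finite_heads: "finite (heads \<sigma> t)"
  by (induction t) auto

text \<open>The \<open>+ 1\<close> is for a variable, which has size 0 and one head; each binary
  operator pays for joining two sets of heads.\<close>

lemma card_heads: "card (heads \<sigma> t) \<le> tsize t + 1"
proof (induction t)
  case (Sum t u)
  then show ?case using card_Un_le[of "heads \<sigma> t" "heads \<sigma> u"] by simp
next
  case (Par t u)
  then show ?case using card_Un_le[of "heads \<sigma> t" "heads \<sigma> u"] by simp
qed auto

lemma tsize_heads: "v \<in> heads \<sigma> t \<Longrightarrow> tsize v \<le> tsize t"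
  by (induction t) (auto split: if_splits)

lemma Par_in_heads_nonzero:
  "v \<parallel> w \<in> heads \<sigma> t \<Longrightarrow> depth (tsubst \<sigma> v) \<noteq> 0 \<and> depth (tsubst \<sigma> w) \<noteq> 0"
  by (induction t) (auto split: if_splits)

lemma Sum_notin_heads: "v \<oplus> w \<notin> heads \<sigma> t"
  by (induction t) auto

section \<open>The invariant \<open>par_move\<close> and unguarded occurrences of variables\<close>

text \<open>The counterpart of \<open>heads\<close> for a process: trivial factors are skipped in
  the same way, and the search stops at the first composition of two nontrivial factors.\<close>

primrec par_move :: "'a \<Rightarrow> ('a, 'v) trm \<Rightarrow> bool" where
  "par_move a Zero \<longleftrightarrow> False"
| "par_move a (Var x) \<longleftrightarrow> False"
| "par_move a (Pre c p) \<longleftrightarrow> False"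
| "par_move a (p \<oplus> q) \<longleftrightarrow> par_move a p \<or> par_move a q"
| "par_move a (p \<parallel> q) \<longleftrightarrow>
     depth q = 0 \<and> par_move a p \<or> depth p = 0 \<and> par_move a q \<or>
     depth p \<noteq> 0 \<and> depth q \<noteq> 0 \<and> [a] \<in> traces (p \<parallel> q)"

lemma par_move_trace: "par_move a p \<Longrightarrow> [a] \<in> traces p"
proof (induction p)
  case (Sum p q)
  then show ?case by (auto simp: singleton_in_traces_iff)
qed (auto simp: singleton_in_traces_Par)

text \<open>Descending through a sum only loses futures, and discarding a trivial factor preserves
  them.\<close>

lemma par_move_witness:
  fixes p :: "('a, 'v) trm"
  assumes "par_move a p"
  obtains q r :: "('a, 'v) trm" where "depth q \<noteq> 0" "depth r \<noteq> 0" "[a] \<in> traces (q \<parallel> r)"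
    "futures (q \<parallel> r) \<subseteq> futures p"
proof -
  have "\<exists>q r :: ('a, 'v) trm. depth q \<noteq> 0 \<and> depth r \<noteq> 0 \<and> [a] \<in> traces (q \<parallel> r) \<and> futures (q \<parallel> r) \<subseteq> futures p"
    using assms
  proof (induction p)
    case (Sum p q)
    then show ?case by (auto, blast+)
  next
    case (Par p q)
    show ?case
    proof (cases "depth p = 0 \<or> depth q = 0")
      case True
      moreover have nz: "par_move a r \<Longrightarrow> depth r \<noteq> 0" for r :: "('a, 'v) trm"
        using par_move_trace singleton_in_traces_depth by fastforce
      ultimately show ?thesis using Par by (auto simp: futures_Par_zero dest: nz)
    next
      case False
      with Par.prems show ?thesis by (intro exI[of _ p] exI[of _ q]) auto
    qed
  qed auto
  then show ?thesis using that by blast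
qed

text \<open>The composition responsible for the move lies either inside the value of a variable or
  at an operator of \<open>t\<close> itself.\<close>

lemma par_move_tsubst:
  assumes "par_move a (tsubst \<sigma> t)"
  obtains x where "Var x \<in> heads \<sigma> t" "par_move a (\<sigma> x)"
    | v w where "v \<parallel> w \<in> heads \<sigma> t" "[a] \<in> traces (tsubst \<sigma> (v \<parallel> w))"
proof -
  have "(\<exists>x. Var x \<in> heads \<sigma> t \<and> par_move a (\<sigma> x)) \<or>
        (\<exists>v w. v \<parallel> w \<in> heads \<sigma> t \<and> [a] \<in> traces (tsubst \<sigma> (v \<parallel> w)))"
    using assms by (induction t) auto
  then show ?thesis using that by blast
qed

lemma par_move_Var_head:
  "Var x \<in> heads \<sigma> t \<Longrightarrow> par_move a (\<sigma> x) \<Longrightarrow> par_move a (tsubst \<sigma> t)"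
  by (induction t) (auto split: if_splits)

text \<open>\<open>residual x t w\<close>: an occurrence of \<open>x\<close> in \<open>t\<close> is not guarded by a prefix, and \<open>w\<close> is what
  remains in parallel with it once that occurrence makes a move.\<close>

inductive residual :: "'v \<Rightarrow> ('a, 'v) trm \<Rightarrow> ('a, 'v) trm \<Rightarrow> bool" for x where
  Var: "residual x (Var x) Zero"
| Sum_left: "residual x t w \<Longrightarrow> residual x (t \<oplus> u) w"
| Sum_right: "residual x t w \<Longrightarrow> residual x (u \<oplus> t) w"
| Par_left: "residual x t w \<Longrightarrow> residual x (t \<parallel> u) (w \<parallel> u)"
| Par_right: "residual x t w \<Longrightarrow> residual x (u \<parallel> t) (u \<parallel> w)"

lemma residual_vars: "residual x t w \<Longrightarrow> x \<in> vars t"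
  by (induction rule: residual.induct) auto

text \<open>A trivial residual means that everything in parallel with the occurrence of
  \<open>x\<close> is trivial, so \<open>heads\<close> discards it and keeps
  \<open>x\<close>.\<close>

lemma residual_zero:
  assumes "residual x t w" "depth (tsubst \<sigma> w) = 0"
  shows "Var x \<in> heads \<sigma> t"
  using assms by (induction rule: residual.induct) auto

text \<open>The factor containing \<open>x\<close> is nontrivial because \<open>x\<close> is, and
  whatever performs \<open>a\<close> beside it is nontrivial too; where the two meet, the
  composition has two nontrivial factors.\<close>

lemma residual_par_move:
  assumes "residual x t w" "depth (\<sigma> x) > 0" "[a] \<in> traces (tsubst \<sigma> w)"
  shows "par_move a (tsubst \<sigma> t)"
  using assms
proof (induction rule: residual.induct)
  case (Par_left t w u)
  then have "depth (tsubst \<sigma> t) > 0"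
    using depth_tsubst_vars[OF residual_vars, of x t w \<sigma>] by auto
  then show ?case
    using Par_left singleton_in_traces_depth[of a "tsubst \<sigma> u"] par_move_trace[of a "tsubst \<sigma> t"]
    by (auto simp: singleton_in_traces_Par)
next
  case (Par_right t w u)
  then have "depth (tsubst \<sigma> t) > 0"
    using depth_tsubst_vars[OF residual_vars, of x t w \<sigma>] by auto
  then show ?case
    using Par_right singleton_in_traces_depth[of a "tsubst \<sigma> u"] par_move_trace[of a "tsubst \<sigma> t"]
    by (auto simp: singleton_in_traces_Par)
qed (auto dest: singleton_in_traces_depth)

section \<open>Moves of an instance when the value of one variable changes\<close>

text \<open>A step either leaves the value \<open>z\<close> of \<open>x\<close> alone, and then
  works with \<open>Zero\<close> for \<open>x\<close> as well, or it is a move of \<open>z\<close>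
  at an unguarded \<open>x\<close>. In the latter case \<open>r\<close> has \<open>s\<close> where
  the residual has \<open>Zero\<close>; only depth and actions of \<open>r\<close> are recorded, as
  they do not depend on that position.\<close>

lemma step_tsubst_upd:
  fixes \<sigma> :: "'v \<Rightarrow> ('a, 'v) trm"
  assumes "closed_subst \<sigma>" "step (tsubst (\<sigma>(x := z)) t) c r"
  shows "(\<exists>w. r = tsubst (\<sigma>(x := z)) w \<and>
              step (tsubst (\<sigma>(x := Zero)) t) c (tsubst (\<sigma>(x := Zero)) w)) \<or>
         (\<exists>w s. residual x t w \<and> step z c s \<and>
              depth r = depth (tsubst (\<sigma>(x := z)) w) + depth s \<and>
              trace_acts r = trace_acts (tsubst (\<sigma>(x := z)) w) \<union> trace_acts s)"
  using assms(2)
proof (induction t arbitrary: r)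
  case (Var y)
  show ?case
  proof (cases "y = x")
    case True
    then show ?thesis using Var by (intro disjI2 exI[of _ Zero] exI[of _ r]) (auto intro: residual.Var)
  next
    case False
    then have "step (\<sigma> y) c r" using Var by simp
    \<comment> \<open>Being closed, \<open>r\<close> is unaffected by substitution and can itself
      serve as \<open>w\<close>.\<close>
    then have "vars r = {}" using assms(1) step_vars by (fastforce simp: closed_subst_def closed_def)
    then have r: "tsubst \<tau> r = r" for \<tau> by (simp add: tsubst_closed)
    then show ?thesis using False \<open>step (\<sigma> y) c r\<close>
      by (intro disjI1 exI[of _ r] conjI) (simp_all add: r)
  qed
next
  case (Sum t u)
  from Sum.prems consider "step (tsubst (\<sigma>(x := z)) t) c r" | "step (tsubst (\<sigma>(x := z)) u) c r"
    by (auto simp del: fun_upd_apply)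
  then show ?case
  proof cases
    case 1
    from Sum.IH(1)[OF this] show ?thesis
      unfolding tsubst.simps step_simps by (blast intro: residual.Sum_left)
  next
    case 2
    from Sum.IH(2)[OF this] show ?thesis
      unfolding tsubst.simps step_simps by (blast intro: residual.Sum_right)
  qed
next
  case (Par t u)
  let ?\<sigma> = "\<sigma>(x := z)" and ?\<rho> = "\<sigma>(x := Zero)"
  from Par.prems consider r' where "step (tsubst ?\<sigma> t) c r'" "r = r' \<parallel> tsubst ?\<sigma> u"
    | r' where "step (tsubst ?\<sigma> u) c r'" "r = tsubst ?\<sigma> t \<parallel> r'"
    by (auto simp: step_Par_iff simp del: fun_upd_apply)
  then show ?case
  proof cases
    case 1
    from Par.IH(1)[OF 1(1)] show ?thesis
    proof (elim disjE exE conjE)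
      fix w assume "r' = tsubst ?\<sigma> w" "step (tsubst ?\<rho> t) c (tsubst ?\<rho> w)"
      then show ?thesis using 1 by (intro disjI1 exI[of _ "w \<parallel> u"]) (auto simp: step_Par_iff simp del: fun_upd_apply)
    next
      fix w s assume "residual x t w" "step z c s" "depth r' = depth (tsubst ?\<sigma> w) + depth s"
        "trace_acts r' = trace_acts (tsubst ?\<sigma> w) \<union> trace_acts s"
      then show ?thesis using 1
        by (intro disjI2 exI[of _ "w \<parallel> u"] exI[of _ s]) (simp_all add: trace_acts_Par residual.Par_left Un_ac del: fun_upd_apply)
    qed
  next
    case 2
    from Par.IH(2)[OF 2(1)] show ?thesis
    proof (elim disjE exE conjE)
      fix w assume "r' = tsubst ?\<sigma> w" "step (tsubst ?\<rho> u) c (tsubst ?\<rho> w)"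
      then show ?thesis using 2 by (intro disjI1 exI[of _ "t \<parallel> w"]) (auto simp: step_Par_iff simp del: fun_upd_apply)
    next
      fix w s assume "residual x u w" "step z c s" "depth r' = depth (tsubst ?\<sigma> w) + depth s"
        "trace_acts r' = trace_acts (tsubst ?\<sigma> w) \<union> trace_acts s"
      then show ?thesis using 2
        by (intro disjI2 exI[of _ "t \<parallel> w"] exI[of _ s]) (simp_all add: trace_acts_Par residual.Par_right Un_ac del: fun_upd_apply)
    qed
  qed
qed auto

text \<open>The value of \<open>x\<close> can only start with \<open>a\<close>, so a word without
  \<open>a\<close> never sets it in motion.\<close>

lemma path_tsubst_upd:
  fixes \<sigma> :: "'v \<Rightarrow> ('a, 'v) trm"
  assumes "closed_subst \<sigma>" "path (tsubst (\<sigma>(x := Pre a z)) t) \<alpha> r" "a \<notin> set \<alpha>"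
  shows "\<exists>w. path (tsubst (\<sigma>(x := Zero)) t) \<alpha> (tsubst (\<sigma>(x := Zero)) w)"
  using assms(2,3)
proof (induction \<alpha> arbitrary: t)
  case (Cons c \<alpha>)
  then obtain s where s: "step (tsubst (\<sigma>(x := Pre a z)) t) c s" "path s \<alpha> r"
    unfolding path_Cons_iff by blast
  moreover have "c \<noteq> a" "a \<notin> set \<alpha>" using Cons.prems by auto
  ultimately obtain w where
    w: "s = tsubst (\<sigma>(x := Pre a z)) w" "step (tsubst (\<sigma>(x := Zero)) t) c (tsubst (\<sigma>(x := Zero)) w)"
    using step_tsubst_upd[OF assms(1) s(1)] by (auto simp del: fun_upd_apply)
  with Cons.IH[of w] s(2) \<open>a \<notin> set \<alpha>\<close> show ?case unfolding path_Cons_iff by blast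
qed auto

section \<open>Probing a variable with a followed by \<open>bs b M\<close>\<close>

abbreviation bs :: "'a \<Rightarrow> nat \<Rightarrow> ('a, 'v) trm" where
  "bs b M \<equiv> (Pre b ^^ M) Zero"

lemma depth_bs: "depth (bs b M) = M"
  by (induction M) auto

lemma replicate_in_traces_bs: "replicate M b \<in> traces (bs b M)"
  by (induction M) (auto simp: traces_def path_Cons_iff)

lemma path_bs_set: "path (bs b M) \<alpha> r \<Longrightarrow> set \<alpha> \<subseteq> {b}"
proof (induction M arbitrary: \<alpha>)
  case (Suc M)
  then show ?case by (cases \<alpha>) (auto simp: path_Cons_iff)
qed auto

lemma trace_acts_bs: "trace_acts (bs b M) \<subseteq> {b}"
  using path_bs_set by (fastforce simp: trace_acts_def traces_def)

lemma closed_bs: "closed (bs b M)"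
  by (induction M) (auto simp: closed_def)

text \<open>If the \<open>a\<close> step did not move \<open>x\<close>, the following
  \<open>M\<close> b's could not do so either, as the probe is guarded by \<open>a\<close>. Then
  they would be possible with \<open>Zero\<close> for \<open>x\<close>, contradicting the choice of
  \<open>M\<close>. So \<open>x\<close> moves.\<close>

lemma residual_if_future:
  fixes \<sigma> :: "'v \<Rightarrow> ('a, 'v) trm"
  assumes "closed_subst \<sigma>" "a \<noteq> b" "depth (tsubst (\<sigma>(x := Zero)) t) < M"
    and \<tau>: "\<tau> = \<sigma>(x := Pre a (bs b M))"
    and fut: "([a], X) \<in> futures (tsubst \<tau> t)" and M: "replicate M b \<in> X"
  obtains w and r :: "('a, 'v) trm" where "residual x t w" "X = traces r" "depth r = depth (tsubst \<tau> w) + M"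
    "trace_acts r \<subseteq> trace_acts (tsubst \<tau> w) \<union> {b}"
proof -
  from fut obtain r where r: "step (tsubst \<tau> t) a r" "X = traces r"
    by (auto elim!: futures_memE simp: path_Cons_iff)
  have "\<not> (\<exists>w. r = tsubst \<tau> w \<and> step (tsubst (\<sigma>(x := Zero)) t) a (tsubst (\<sigma>(x := Zero)) w))"
  proof (intro notI, elim exE conjE)
    fix w assume w: "r = tsubst \<tau> w" "step (tsubst (\<sigma>(x := Zero)) t) a (tsubst (\<sigma>(x := Zero)) w)"
    from M r(2) w(1) obtain r' where "path (tsubst \<tau> w) (replicate M b) r'"
      by (auto simp: traces_def)
    then obtain w' where "path (tsubst (\<sigma>(x := Zero)) w) (replicate M b) w'"
      using path_tsubst_upd[OF assms(1), of x a "bs b M" w] \<open>a \<noteq> b\<close> \<tau> by fastforce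
    then have "M \<le> depth (tsubst (\<sigma>(x := Zero)) w)" using path_depth by fastforce
    then show False using step_depth[OF w(2)] assms(3) by simp
  qed
  with step_tsubst_upd[OF assms(1) r(1)[unfolded \<tau>]] \<tau> obtain w s where
    "residual x t w" "step (Pre a (bs b M) :: ('a, 'v) trm) a s" "depth r = depth (tsubst \<tau> w) + depth s"
    "trace_acts r = trace_acts (tsubst \<tau> w) \<union> trace_acts s" by auto
  moreover from this have "s = bs b M" by simp
  ultimately have "depth r = depth (tsubst \<tau> w) + M" "trace_acts r \<subseteq> trace_acts (tsubst \<tau> w) \<union> {b}"
    using trace_acts_bs[where b = b and M = M] depth_bs[where b = b and M = M] by auto
  with \<open>residual x t w\<close> r(2) show ?thesis by (rule that)
qed

text \<open>With the probe at \<open>x\<close>, the left side does \<open>a\<close> and reaches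
  exactly the traces of \<open>bs b M\<close>. On the right \<open>x\<close> must move, and
  \<open>bs b M\<close> exhausts the depth, so the residual is trivial and \<open>x\<close> is a
  head of \<open>u\<close> too.\<close>

lemma par_move_if_Var_head:
  fixes \<sigma> :: "'v \<Rightarrow> ('a, 'v) trm"
  assumes "closed_subst \<sigma>" "a \<noteq> b"
    and sound: "\<And>\<tau> :: 'v \<Rightarrow> ('a, 'v) trm. closed_subst \<tau> \<Longrightarrow> futures (tsubst \<tau> t) = futures (tsubst \<tau> u)"
    and x: "Var x \<in> heads \<sigma> t" "par_move a (\<sigma> x)"
  shows "par_move a (tsubst \<sigma> u)"
proof -
  define M where "M = Suc (depth (tsubst (\<sigma>(x := Zero)) u))"
  then have less: "depth (tsubst (\<sigma>(x := Zero)) u) < M" by simp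
  define \<tau> where "\<tau> = \<sigma>(x := Pre a (bs b M))"
  have nz: "depth (\<sigma> x) \<noteq> 0"
    using singleton_in_traces_depth[OF par_move_trace[OF x(2)]] by simp
  \<comment> \<open>Old and new value of \<open>x\<close> are both nontrivial, so the heads stay the
    same.\<close>
  then have zero_iff: "depth (\<sigma> y) = 0 \<longleftrightarrow> depth (\<tau> y) = 0" for y by (simp add: \<tau>_def)
  have heads: "heads \<sigma> t = heads \<tau> t" for t by (rule heads_cong) (rule zero_iff)
  have "closed_subst \<tau>" using assms(1) closed_bs[where b = b and M = M]
    by (auto simp: closed_subst_def closed_def \<tau>_def)
  have "([a], traces (bs b M :: ('a, 'v) trm)) \<in> futures (tsubst \<tau> (Var x))"
    by (rule futures_memI) (auto simp: \<tau>_def path_Cons_iff)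
  then have "([a], traces (bs b M :: ('a, 'v) trm)) \<in> futures (tsubst \<tau> u)"
    using futures_head_subset[of "Var x" \<tau> t] x(1) heads[of t] sound[OF \<open>closed_subst \<tau>\<close>] by auto
  moreover have "replicate M b \<in> traces (bs b M :: ('a, 'v) trm)"
    by (rule replicate_in_traces_bs)
  ultimately obtain w and r :: "('a, 'v) trm" where wr: "residual x u w"
    "traces (bs b M :: ('a, 'v) trm) = traces r" "depth r = depth (tsubst \<tau> w) + M"
    "trace_acts r \<subseteq> trace_acts (tsubst \<tau> w) \<union> {b}"
    by (rule residual_if_future[OF assms(1,2) less \<tau>_def])
  then have "depth (tsubst \<tau> w) = 0"
    using depth_cong[OF wr(2)] by (simp add: depth_bs)
  then have "Var x \<in> heads \<sigma> u"
    using residual_zero[OF wr(1)] heads by blast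
  then show ?thesis using x(2) by (rule par_move_Var_head)
qed

text \<open>When the probe at \<open>x\<close> does its \<open>a\<close>, the left side reaches the
  traces of \<open>a\<close> in parallel with \<open>bs b M\<close>, of depth \<open>M + 1\<close>.
  On the right \<open>x\<close> must move too; \<open>bs b M\<close> accounts for depth
  \<open>M\<close>, so the residual has depth 1 and must supply the other \<open>a\<close>.\<close>

lemma par_move_if_Par_head:
  fixes \<sigma> :: "'v \<Rightarrow> ('a, 'v) trm"
  assumes "closed_subst \<sigma>" "a \<noteq> b"
    and sub: "\<And>\<tau> :: 'v \<Rightarrow> ('a, 'v) trm. closed_subst \<tau> \<Longrightarrow> heads \<sigma> = heads \<tau> \<Longrightarrow>
      futures (tsubst \<tau> v \<parallel> tsubst \<tau> w) \<subseteq> futures (tsubst \<tau> u)"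
    and v: "futures (tsubst \<sigma> v) = futures (Pre a Zero :: ('a, 'v) trm)"
    and x: "Var x \<in> heads \<sigma> w" "depth (\<sigma> x) \<ge> 2"
  shows "par_move a (tsubst \<sigma> u)"
proof -
  define M where "M = Suc (depth (tsubst (\<sigma>(x := Zero)) u))"
  then have less: "depth (tsubst (\<sigma>(x := Zero)) u) < M" by simp
  define \<tau> where "\<tau> = \<sigma>(x := Pre a (bs b M))"
  have zero_iff: "depth (\<sigma> y) = 0 \<longleftrightarrow> depth (\<tau> y) = 0" for y using x(2) by (simp add: \<tau>_def)
  have heads: "heads \<sigma> t = heads \<tau> t" for t by (rule heads_cong) (rule zero_iff)
  have "closed_subst \<tau>" using assms(1) closed_bs[where b = b and M = M]
    by (auto simp: closed_subst_def closed_def \<tau>_def)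
  have tr_v: "traces (tsubst \<sigma> v) = traces (Pre a Zero :: ('a, 'v) trm)"
    using v by (simp add: traces_eq[of "tsubst \<sigma> v"] traces_eq[of "Pre a Zero"])
  \<comment> \<open>\<open>v\<close> has depth 1 under \<sigma> and the value of \<open>x\<close> at
    least 2, so the probe leaves \<open>v\<close> unchanged.\<close>
  then have "x \<notin> vars v"
    using depth_tsubst_vars[of x v \<sigma>] depth_cong[OF tr_v] x(2) by auto
  then have \<tau>_v: "tsubst \<tau> v = tsubst \<sigma> v"
    by (intro tsubst_cong) (auto simp: \<tau>_def)
  have "([a], traces (bs b M :: ('a, 'v) trm)) \<in> futures (tsubst \<tau> (Var x))"
    by (rule futures_memI) (auto simp: \<tau>_def path_Cons_iff)
  then have "([a], traces (bs b M :: ('a, 'v) trm)) \<in> futures (tsubst \<tau> w)"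
    using futures_head_subset[of "Var x" \<tau> w] x(1) heads[of w] by auto
  then obtain s where s: "path (tsubst \<tau> w) [a] s" "traces (bs b M :: ('a, 'v) trm) = traces s"
    by (auto elim: futures_memE)
  have "path (tsubst \<tau> v \<parallel> tsubst \<tau> w) [a] (tsubst \<tau> v \<parallel> s)"
    using s(1) by (auto simp: path_Cons_iff step_Par_iff)
  then have fut: "([a], traces (tsubst \<tau> v \<parallel> s)) \<in> futures (tsubst \<tau> u)"
    using futures_memI sub[OF \<open>closed_subst \<tau>\<close>] heads by blast
  have "replicate M b \<in> traces s"
    unfolding s(2)[symmetric] by (rule replicate_in_traces_bs)
  then have "replicate M b \<in> traces (tsubst \<tau> v \<parallel> s)" using traces_subset_Par by blast
  with fut obtain x' and r :: "('a, 'v) trm" where r: "residual x u x'" "traces (tsubst \<tau> v \<parallel> s) = traces r"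
    "depth r = depth (tsubst \<tau> x') + M" "trace_acts r \<subseteq> trace_acts (tsubst \<tau> x') \<union> {b}"
    by (rule residual_if_future[OF assms(1,2) less \<tau>_def])
  have "depth (tsubst \<tau> v \<parallel> s) = Suc M"
    using depth_cong[OF tr_v] depth_cong[OF s(2)] \<tau>_v by (simp add: depth_bs)
  then have depth_x': "depth (tsubst \<tau> x') = 1" using r(3) depth_cong[OF r(2)] by simp
  \<comment> \<open>The probe has depth \<open>M + 1\<close>, which is at least 2, so it does not
    fit into \<open>x'\<close>; hence \<sigma> and \<tau> agree on \<open>x'\<close>.\<close>
  then have "x \<notin> vars x'"
    using depth_tsubst_vars[of x x' \<tau>] by (auto simp: \<tau>_def depth_bs M_def)
  then have "tsubst \<tau> x' = tsubst \<sigma> x'"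
    by (intro tsubst_cong) (auto simp: \<tau>_def)
  have "[a] \<in> traces (tsubst \<sigma> v)" unfolding tr_v by (auto simp: traces_def path_Cons_iff)
  then have "[a] \<in> traces r" using \<tau>_v r(2) traces_subset_Par(1) by fastforce
  then have "a \<in> trace_acts r" by (force simp: trace_acts_def)
  then have "a \<in> trace_acts (tsubst \<tau> x')" using r(4) \<open>a \<noteq> b\<close> by auto
  then obtain \<beta> where \<beta>: "\<beta> \<in> traces (tsubst \<tau> x')" "a \<in> set \<beta>" by (auto simp: trace_acts_def)
  then have "\<beta> = [a]" using traces_length[OF \<beta>(1)] depth_x' by (cases \<beta>) auto
  then show ?thesis
    using residual_par_move[OF r(1), of \<sigma> a] x(2) \<beta>(1) \<open>tsubst \<tau> x' = tsubst \<sigma> x'\<close> by simp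
qed

text \<open>A head of \<open>v\<close> that is not a variable accounts for at most one of the \<open>N\<close> summands
  of \<open>pN a b N\<close>, and \<open>v\<close> has fewer than \<open>N\<close> heads.\<close>

lemma Var_head_of_pN:
  fixes v :: "('a, 'v) trm" and \<sigma> :: "'v \<Rightarrow> ('a, 'w) trm"
  assumes "a \<noteq> b" "tsize v + 1 < N" and fut: "futures (tsubst \<sigma> v) = futures (pN a b N :: ('a, 'w) trm)"
  obtains x where "Var x \<in> heads \<sigma> v" "depth (\<sigma> x) \<ge> 2"
proof -
  have "\<exists>h \<in> heads \<sigma> v. replicate i b @ [a] \<in> traces (tsubst \<sigma> h)" if "i \<in> {1..N}" for i
  proof -
    have "replicate i b @ [a] \<in> traces (pN a b N :: ('a, 'w) trm)"
      using traces_pN[OF \<open>a \<noteq> b\<close>] that by blast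
    then have "replicate i b @ [a] \<in> fst ` futures (tsubst \<sigma> v)" using fut by (simp add: traces_eq)
    then show ?thesis by (auto simp: futures_heads[of \<sigma> v] traces_eq)
  qed
  then obtain h where h: "\<And>i. i \<in> {1..N} \<Longrightarrow> h i \<in> heads \<sigma> v"
    "\<And>i. i \<in> {1..N} \<Longrightarrow> replicate i b @ [a] \<in> traces (tsubst \<sigma> (h i))" by metis
  have "card (h ` {1..N}) \<le> card (heads \<sigma> v)"
    using h(1) by (intro card_mono finite_heads) auto
  also have "\<dots> < card {1..N}" using card_heads[of \<sigma> v] assms(2) by simp
  finally have "\<not> inj_on h {1..N}" by (rule pigeonhole)
  then obtain i j where ij: "i \<in> {1..N}" "j \<in> {1..N}" "h i = h j" "i \<noteq> j" by (auto simp: inj_on_def)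
  have sub: "futures (tsubst \<sigma> (h i)) \<subseteq> futures (pN a b N :: ('a, 'w) trm)"
    using futures_head_subset[OF h(1)[OF ij(1)]] fut by simp
  have tr_i: "replicate i b @ [a] \<in> traces (tsubst \<sigma> (h i))"
    and tr_j: "replicate j b @ [a] \<in> traces (tsubst \<sigma> (h i))"
    using h(2)[OF ij(1)] h(2)[OF ij(2)] ij(3) by simp_all
  show thesis
  proof (cases "h i")
    case Zero
    with tr_i show ?thesis by (simp add: traces_def)
  next
    case (Var x)
    moreover have "length (replicate i b @ [a]) \<le> depth (\<sigma> x)"
      using traces_length[OF tr_i] Var by simp
    ultimately show ?thesis using that h(1)[OF ij(1)] ij(1) by auto
  next
    case (Pre c t)
    have "([c], traces (tsubst \<sigma> t)) \<in> futures (tsubst \<sigma> (h i))"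
      using Pre by (intro futures_memI) (auto simp: path_Cons_iff)
    with sub have "([c], traces (tsubst \<sigma> t)) \<in> futures (pN a b N :: ('a, 'w) trm)" by blast
    \<comment> \<open>After one letter the traces are those of a single \<open>bpow b a k\<close>,
      which admits only one of b^(i-1) a and b^(j-1) a.\<close>
    then obtain k where "traces (tsubst \<sigma> t) = traces (bpow b a k :: ('a, 'w) trm)"
      by (cases rule: futures_pN_cases) (auto simp: Cons_eq_append_conv)
    moreover have "replicate (l - 1) b @ [a] \<in> traces (tsubst \<sigma> t)"
      if "replicate l b @ [a] \<in> traces (tsubst \<sigma> (h i))" "l \<in> {1..N}" for l
      using that Pre by (cases l) (auto simp: traces_def path_Cons_iff)
    ultimately have "k = i - 1" "k = j - 1"
      using tr_i tr_j ij(1,2) replicate_snoc_in_traces_bpow[OF \<open>a \<noteq> b\<close>] by metis+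
    then show ?thesis using ij by auto
  next
    case (Sum t u)
    with h(1)[OF ij(1)] show ?thesis by (simp add: Sum_notin_heads)
  next
    case (Par t u)
    then have "depth (tsubst \<sigma> t) \<noteq> 0 \<and> depth (tsubst \<sigma> u) \<noteq> 0"
      using h(1)[OF ij(1)] by (intro Par_in_heads_nonzero) simp
    moreover have "depth (tsubst \<sigma> t) = 0 \<or> depth (tsubst \<sigma> u) = 0"
      using sub Par by (intro pN_parallel_prime[OF \<open>a \<noteq> b\<close>]) simp
    ultimately show ?thesis by simp
  qed
qed

section \<open>Invariance of \<open>par_move\<close> under axioms and derivations\<close>

text \<open>A move inside the value of a variable transfers by \<open>par_move_if_Var_head\<close>.
  A parallel head of \<open>t\<close> splits into parts equivalent to \<open>a\<close> and to
  \<open>pN\<close>; the latter, being smaller than \<open>N\<close>, has a variable head that can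
  be probed.\<close>

lemma par_move_axiom:
  fixes \<sigma> :: "'v \<Rightarrow> ('a, 'v) trm"
  assumes "closed_subst \<sigma>" "a \<noteq> b"
    and sound: "\<And>\<tau> :: 'v \<Rightarrow> ('a, 'v) trm. closed_subst \<tau> \<Longrightarrow> futures (tsubst \<tau> t) = futures (tsubst \<tau> u)"
    and size: "tsize t < N"
    and fut: "futures (tsubst \<sigma> t) = futures (Pre a Zero \<parallel> pN a b N :: ('a, 'v) trm)"
    and "par_move a (tsubst \<sigma> t)"
  shows "par_move a (tsubst \<sigma> u)"
  using assms(6)
proof (cases rule: par_move_tsubst)
  case (1 x)
  then show ?thesis using par_move_if_Var_head[OF assms(1,2), of t u x] sound by blast
next
  case (2 v w)
  have nz: "depth (tsubst \<sigma> v) > 0" "depth (tsubst \<sigma> w) > 0"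
    using Par_in_heads_nonzero[OF 2(1)] by simp_all
  have small: "tsize v + 1 < N" "tsize w + 1 < N"
    using tsize_heads[OF 2(1)] size by simp_all
  have sub: "futures (tsubst \<tau> v \<parallel> tsubst \<tau> w) \<subseteq> futures (tsubst \<tau> u)"
    if "closed_subst \<tau>" "heads \<sigma> = heads \<tau>" for \<tau> :: "'v \<Rightarrow> ('a, 'v) trm"
    using futures_head_subset[of "v \<parallel> w" \<tau> t] 2(1) that(2) sound[OF that(1)] by simp
  have fut': "futures (tsubst \<sigma> u) = futures (Pre a Zero \<parallel> pN a b N :: ('a, 'v) trm)"
    using fut sound[OF assms(1)] by simp
  \<comment> \<open>Stated for arbitrary \<open>v\<close> and \<open>w\<close>, since either factor
    may be the one that performs \<open>a\<close>.\<close>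
  have par_move: "par_move a (tsubst \<sigma> u)"
    if v: "[a] \<in> traces (tsubst \<sigma> v)" and nz: "depth (tsubst \<sigma> v) > 0" "depth (tsubst \<sigma> w) > 0"
      and small: "tsize w + 1 < N"
      and sub: "\<And>\<tau> :: 'v \<Rightarrow> ('a, 'v) trm. closed_subst \<tau> \<Longrightarrow> heads \<sigma> = heads \<tau> \<Longrightarrow>
        futures (tsubst \<tau> v \<parallel> tsubst \<tau> w) \<subseteq> futures (tsubst \<tau> u)" for v w
  proof -
    have "futures (tsubst \<sigma> v \<parallel> tsubst \<sigma> w) \<subseteq> futures (Pre a Zero \<parallel> pN a b N :: ('a, 'v) trm)"
      using sub[OF assms(1) HOL.refl] fut' by simp
    moreover have "N > 0" using small by simp
    ultimately have fut_v: "futures (tsubst \<sigma> v) = futures (Pre a Zero :: ('a, 'v) trm)"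
      and fut_w: "futures (tsubst \<sigma> w) = futures (pN a b N :: ('a, 'v) trm)"
      using decompose_a_pN[OF \<open>a \<noteq> b\<close>] nz v by blast+
    obtain x where "Var x \<in> heads \<sigma> w" "depth (\<sigma> x) \<ge> 2"
      using Var_head_of_pN[OF \<open>a \<noteq> b\<close> small fut_w] .
    then show ?thesis
      using par_move_if_Par_head[OF assms(1,2) sub fut_v] by blast
  qed
  from 2(2) consider "[a] \<in> traces (tsubst \<sigma> v)" | "[a] \<in> traces (tsubst \<sigma> w)"
    by (auto simp: singleton_in_traces_Par)
  then show ?thesis
  proof cases
    case 1
    then show ?thesis using par_move[OF 1 nz small(2) sub] by blast
  next
    case 2
    have "futures (tsubst \<tau> w \<parallel> tsubst \<tau> v) \<subseteq> futures (tsubst \<tau> u)"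
      if "closed_subst \<tau>" "heads \<sigma> = heads \<tau>" for \<tau> :: "'v \<Rightarrow> ('a, 'v) trm"
      using sub[OF that] by (simp add: futures_Par_commute)
    then show ?thesis using par_move[OF 2 nz(2,1) small(1)] by blast
  qed
qed

text \<open>The witness of \<open>par_move\<close> decomposes into \<open>a\<close> and
  \<open>pN\<close>, so it already has all the futures, and \<open>p\<close> lies between it and
  \<open>a \<parallel> p\<^sub>N\<close>.\<close>

lemma futures_eq_if_par_move:
  fixes p :: "('a, 'v) trm"
  assumes "a \<noteq> b" "N > 0" "par_move a p"
    and sub: "futures p \<subseteq> futures (Pre a Zero \<parallel> pN a b N :: ('a, 'v) trm)"
  shows "futures p = futures (Pre a Zero \<parallel> pN a b N :: ('a, 'v) trm)"
proof -
  let ?F = "futures (Pre a Zero \<parallel> pN a b N :: ('a, 'v) trm)"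
  obtain q r :: "('a, 'v) trm" where qr: "depth q \<noteq> 0" "depth r \<noteq> 0" "[a] \<in> traces (q \<parallel> r)"
    "futures (q \<parallel> r) \<subseteq> futures p"
    using \<open>par_move a p\<close> by (rule par_move_witness)
  have Par: "futures (q \<parallel> r) = ?F"
    if "[a] \<in> traces q" "futures (q \<parallel> r) \<subseteq> ?F" "depth q \<noteq> 0" "depth r \<noteq> 0" for q r :: "('a, 'v) trm"
    using decompose_a_pN[OF assms(1,2) that(2) _ _ that(1)] that(3,4) by (intro futures_Par_cong) simp_all
  from qr(3) have "futures (q \<parallel> r) = ?F"
    using Par[of q r] Par[of r q] qr(1,2,4) sub futures_Par_commute[of q r]
    by (auto simp: singleton_in_traces_Par)
  with qr(4) sub show ?thesis by simp
qed

lemma depth_futures_cong: "futures p = futures q \<Longrightarrow> depth p = depth q"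
  by (intro depth_cong) (simp add: traces_eq[of p] traces_eq[of q])

lemma tsubst_tsubst: "tsubst \<sigma> (tsubst \<tau> t) = tsubst (\<lambda>x. tsubst \<sigma> (\<tau> x)) t"
  by (induction t) auto

lemma vars_tsubst: "vars (tsubst \<sigma> t) = (\<Union>x \<in> vars t. vars (\<sigma> x))"
  by (induction t) auto

text \<open>Derivations pass through open terms, so the induction ranges over all closed instances.
  Equality of futures is carried along because it preserves depth and initial actions, on which
  \<open>par_move\<close> depends at a parallel operator.\<close>

lemma derivable_par_move:
  fixes \<sigma> :: "'v \<Rightarrow> ('a, 'v) trm"
  assumes "a \<noteq> b" "N > 0" "pf_sound E" "\<forall>(t, u) \<in> E. tsize t < N \<and> tsize u < N"
    and "derivable E t u" "closed_subst \<sigma>"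
  shows "futures (tsubst \<sigma> t) = futures (tsubst \<sigma> u) \<and>
    (futures (tsubst \<sigma> t) = futures (Pre a Zero \<parallel> pN a b N :: ('a, 'v) trm) \<longrightarrow>
      (par_move a (tsubst \<sigma> t) \<longleftrightarrow> par_move a (tsubst \<sigma> u)))"
  using assms(5,6)
proof (induction arbitrary: \<sigma> rule: derivable.induct)
  case (inst t u \<rho>)
  have sound: "futures (tsubst \<tau> t) = futures (tsubst \<tau> u)" if "closed_subst \<tau>"
    for \<tau> :: "'v \<Rightarrow> ('a, 'v) trm"
    using assms(3) inst(1) that unfolding pf_sound_def pf_equiv_iff by blast
  let ?\<tau> = "\<lambda>x. tsubst \<sigma> (\<rho> x)"
  have closed: "closed_subst ?\<tau>"
    using inst(2) by (simp add: closed_subst_def closed_def vars_tsubst)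
  have size: "tsize t < N" "tsize u < N" using assms(4) inst(1) by auto
  have "par_move a (tsubst ?\<tau> t) \<longleftrightarrow> par_move a (tsubst ?\<tau> u)"
    if fut: "futures (tsubst ?\<tau> t) = futures (Pre a Zero \<parallel> pN a b N :: ('a, 'v) trm)"
  proof
    show "par_move a (tsubst ?\<tau> u)" if "par_move a (tsubst ?\<tau> t)"
      using par_move_axiom[OF closed \<open>a \<noteq> b\<close> sound size(1) fut that] by simp
    show "par_move a (tsubst ?\<tau> t)" if "par_move a (tsubst ?\<tau> u)"
      using par_move_axiom[OF closed \<open>a \<noteq> b\<close> sound[symmetric] size(2) _ that] fut sound[OF closed]
      by simp
  qed
  then show ?case using sound[OF closed] by (simp add: tsubst_tsubst)
next
  case (pre t u c)
  have "futures (tsubst \<sigma> (Pre c t)) = futures (tsubst \<sigma> (Pre c u))"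
    unfolding tsubst.simps using pre.IH[OF pre.prems] by (intro futures_Pre_cong) (rule conjunct1)
  then show ?case by simp
next
  case (sum t u t' u')
  let ?F = "futures (Pre a Zero \<parallel> pN a b N :: ('a, 'v) trm)"
  note IH = sum.IH(1)[OF sum.prems] sum.IH(2)[OF sum.prems]
  have "par_move a (tsubst \<sigma> (t \<oplus> t')) \<longleftrightarrow> par_move a (tsubst \<sigma> (u \<oplus> u'))"
    if fut: "futures (tsubst \<sigma> (t \<oplus> t')) = ?F"
  proof -
    \<comment> \<open>A summand with \<open>par_move\<close> has all futures of the sum, which makes
      the conditional induction hypothesis applicable to it.\<close>
    have "futures p = ?F" if "p \<in> tsubst \<sigma> ` {t, t', u, u'}" "par_move a p" for p
      using that fut IH by (intro futures_eq_if_par_move[OF assms(1,2)]) auto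
    then show ?thesis using IH by auto
  qed
  then show ?case using IH by simp
next
  case (par t u t' u')
  let ?F = "futures (Pre a Zero \<parallel> pN a b N :: ('a, 'v) trm)"
  note IH = par.IH(1)[OF par.prems] par.IH(2)[OF par.prems]
  have depth: "depth (tsubst \<sigma> t) = depth (tsubst \<sigma> u)" "depth (tsubst \<sigma> t') = depth (tsubst \<sigma> u')"
    using IH depth_futures_cong by blast+
  have fut_Par: "futures (tsubst \<sigma> (t \<parallel> t')) = futures (tsubst \<sigma> (u \<parallel> u'))"
    unfolding tsubst.simps using IH by (intro futures_Par_cong) (erule conjunct1)+
  then have "traces (tsubst \<sigma> (t \<parallel> t')) = traces (tsubst \<sigma> (u \<parallel> u'))"
    by (simp add: traces_eq[of "_ \<parallel> _"])
  \<comment> \<open>If one factor is trivial, the other inherits the futures \<open>?F\<close> and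
    the induction hypothesis applies; otherwise the traces decide.\<close>
  then have "par_move a (tsubst \<sigma> (t \<parallel> t')) \<longleftrightarrow> par_move a (tsubst \<sigma> (u \<parallel> u'))"
    if "futures (tsubst \<sigma> (t \<parallel> t')) = ?F"
    using that IH depth by (auto simp: futures_Par_zero)
  then show ?case using fut_Par by simp
next
  case (sym t u)
  then show ?case by metis
next
  case (trans t u v)
  then show ?case by metis
qed simp

section \<open>Summands and factors of closed terms, and the theorem\<close>

lemma summands_subset_subterms: "summands p \<subseteq> subterms p"
  by (induction p) auto

lemma Sum_notin_summands: "t \<oplus> u \<notin> summands p"
  by (induction p) auto

lemma futures_summand: "p' \<in> summands p \<Longrightarrow> futures p' \<subseteq> futures p"
  by (induction p) auto

lemma vars_subterms: "s \<in> subterms p \<Longrightarrow> vars s \<subseteq> vars p"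
  by (induction p) auto

lemma nonzero_if_not_has_zero_factor:
  fixes p :: "('a, 'v) trm"
  assumes "closed p" "\<not> has_zero_factor p" "t \<parallel> u \<in> subterms p"
  shows "depth t \<noteq> 0" "depth u \<noteq> 0"
proof -
  have closed: "closed t" "closed u" "closed (Zero :: ('a, 'v) trm)"
    using vars_subterms[OF assms(3)] assms(1) by (auto simp: closed_def)
  have "\<not> pf_equiv_trm t Zero" "\<not> pf_equiv_trm u Zero"
    using assms(2,3) unfolding has_zero_factor_def by blast+
  then show "depth t \<noteq> 0" "depth u \<noteq> 0"
    using closed by (simp_all add: pf_equiv_trm_closed pf_equiv_iff futures_eq_empty_iff)
qed

lemma par_move_summand:
  "t \<parallel> u \<in> summands p \<Longrightarrow> depth t \<noteq> 0 \<Longrightarrow> depth u \<noteq> 0 \<Longrightarrow> [a] \<in> traces (t \<parallel> u) \<Longrightarrow> par_move a p"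
  by (induction p) auto

text \<open>Without trivial factors \<open>par_move\<close> never looks below a parallel operator,
  so only sums are traversed.\<close>

lemma summand_if_par_move:
  assumes "par_move a p" "\<And>t u. t \<parallel> u \<in> subterms p \<Longrightarrow> depth t \<noteq> 0 \<and> depth u \<noteq> 0"
  shows "\<exists>p' \<in> summands p. par_move a p'"
  using assms by (induction p) auto

lemma derivable_empty: "derivable {} t u \<Longrightarrow> t = u"
  by (induction rule: derivable.induct) auto

theorem theorem6p12:
  fixes a b :: "'a :: finite"
    and E :: "(('a, 'v :: countable) trm \<times> ('a, 'v) trm) set"
    and N :: nat
    and p q :: "('a, 'v) trm"
  assumes "a \<noteq> b"
    and "infinite (UNIV :: 'v set)"
    and "finite E"
    and "pf_sound E"
    and "\<forall>(t, u) \<in> E. tsize t < N \<and> tsize u < N"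
    and "closed p" and "closed q"
    and "\<not> has_zero_summand p" and "\<not> has_zero_factor p"
    and "\<not> has_zero_summand q" and "\<not> has_zero_factor q"
    and "pf_equiv p (Pre a Zero \<parallel> pN a b N)"
    and "pf_equiv q (Pre a Zero \<parallel> pN a b N)"
    and "derivable E p q"
    and "\<exists>p' \<in> summands p. pf_equiv p' (Pre a Zero \<parallel> pN a b N)"
  shows "\<exists>q' \<in> summands q. pf_equiv q' (Pre a Zero \<parallel> pN a b N)"
proof (cases "N = 0")
  case True
  \<comment> \<open>No size is below 0, so the axiom system is empty and derivability is
    identity.\<close>
  with assms(5) have "E = {}" by auto
  then have "p = q" using assms(14) derivable_empty by blast
  then show ?thesis using assms(15) by simp
next
  case False
  then have "N > 0" by simp
  let ?Q = "Pre a Zero \<parallel> pN a b N :: ('a, 'v) trm"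
  have Q_a: "[a] \<in> traces ?Q" 
    unfolding singleton_in_traces_Par by (simp add: singleton_in_traces_iff)
  have "replicate 1 b @ [a] \<in> traces (pN a b N :: ('a, 'v) trm)"
    using \<open>N > 0\<close> by (subst traces_pN[OF \<open>a \<noteq> b\<close>]) simp
  then have Q_b: "[b] \<in> traces ?Q"
    unfolding singleton_in_traces_Par by (auto simp: singleton_in_traces_iff traces_def path_Cons_iff)
  obtain p' where p': "p' \<in> summands p" "pf_equiv p' ?Q" using assms(15) by blast
  then have "traces p' = traces ?Q"
    by (simp add: pf_equiv_iff traces_eq[of p'] traces_eq[of ?Q])
  with Q_a Q_b have ab: "[a] \<in> traces p'" "[b] \<in> traces p'" by simp_all
  \<comment> \<open>Two distinct initial actions exclude a prefix, and a summand is not a sum, so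
    \<open>p'\<close> is a parallel composition, with nontrivial factors.\<close>
  have "par_move a p"
  proof (cases p')
    case (Pre c t)
    then show ?thesis using ab \<open>a \<noteq> b\<close> by (auto simp: singleton_in_traces_iff)
  next
    case (Par t u)
    have "depth t \<noteq> 0" "depth u \<noteq> 0"
      using nonzero_if_not_has_zero_factor[OF assms(6,9)] p'(1) summands_subset_subterms Par by blast+
    then show ?thesis using p'(1) Par ab(1) by (intro par_move_summand[of t u]) simp_all
  next
    case (Sum t u)
    then show ?thesis using p'(1) Sum_notin_summands[of t u p] by simp
  qed (use ab(1) in \<open>auto simp: singleton_in_traces_iff\<close>)
  moreover have "closed_subst (\<lambda>_ :: 'v. Zero :: ('a, 'v) trm)"
    by (simp add: closed_subst_def closed_def)
  moreover have "tsubst (\<lambda>_. Zero) p = p" "tsubst (\<lambda>_. Zero) q = q"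
    using assms(6,7) unfolding closed_def by (auto intro: tsubst_closed)
  moreover have "futures p = futures ?Q" using assms(12) by (simp only: pf_equiv_iff)
  ultimately have "par_move a q"
    using derivable_par_move[OF assms(1) \<open>N > 0\<close> assms(4,5,14), of "\<lambda>_. Zero"] by simp
  then have "\<exists>q' \<in> summands q. par_move a q'"
    by (rule summand_if_par_move) (rule conjI; erule nonzero_if_not_has_zero_factor[OF assms(7,11)])
  then obtain q' where q': "q' \<in> summands q" "par_move a q'" by blast
  \<comment> \<open>A summand of \<open>q\<close> has only futures of \<open>q\<close>;
    \<open>par_move\<close> turns this inclusion into equality.\<close>
  have "futures q' \<subseteq> futures ?Q"
    using futures_summand[OF q'(1)] assms(13) by (simp add: pf_equiv_iff)
  then show ?thesis
    using futures_eq_if_par_move[OF assms(1) \<open>N > 0\<close> q'(2)] q'(1) by (auto simp: pf_equiv_iff)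
qed

end
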